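(* The theory $\mathrm{RKf}+\mathrm{RV}$ is inconsistent, where $\mathrm{RV}$ is the following principle, added as a new axiom (scheme) to $\mathrm{RKf}$: $$\Pr(\Pr(\varphi)=a)\neq 0\ \rightarrow\ \Pr(\varphi\mid \Pr(\varphi)=a)=a .$$
   Context: All theories are in classical first-order logic. $Q^-$ is a standard classical theory of the rational numbers in a language $\mathcal{L}_{Q^-}$ having a predicate $N$ for being a natural number, such that $Q^-$ contains the Peano axioms restricted to $N$ (so syntax can be coded). $\mathcal{L}_Q=\mathcal{L}_{Q^-}\cup\{\Pr\}$, where $\Pr$ is a two-place predicate; $\Pr(x,y)$, also written $\Pr(x)=y$, says that the subjective probability of (the sentence coded by) $x$ is $y$. $Q$ is $Q^-$ with all its logical and nonlogical schemes (including induction) extended to $\mathcal{L}_Q$. $\mathrm{Tm}^c$ is the set of constant terms, $t^\circ$ the value of the term $t$; dotted connectives are the syntactic operations on codes; distinctions between sentences and their codes are suppressed. $\mathrm{RKf}$ has the following axioms and rule (free variables universally quantified, $x,y$ ranging over codes of sentences of $\mathcal{L}_Q$ where they are arguments of $\Pr$, and $\Pr(x)$ being used as a term for the unique value): 1. all axioms of $Q$; 2. $\Pr$ is a function; 3. $\Pr(x,y)\rightarrow (x$ is a sentence of $\mathcal{L}_Q\ \wedge\ 0\le y\le 1)$; 4. $\forall t\in \mathrm{Tm}^c\,(\Pr(\varphi(t))=1\leftrightarrow \varphi(t^\circ))$, for every formula $\varphi$ of $\mathcal{L}_{Q^-}$; 5. $\Pr(x)\le\Pr(x\dot\vee y)$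 and $\Pr(y)\le \Pr(x\dot\vee y)$; 6. $\Pr(x\dot\vee y)=\Pr(x)+\Pr(y)-\Pr(x\dot\wedge y)$; 7. $\Pr(\dot\neg x)=1-\Pr(x)$; 8. (Necessitation rule) from $\vdash\varphi$ infer $\vdash\Pr(\varphi,1)$. In $\mathrm{RV}$, $\varphi$ ranges over sentences of $\mathcal{L}_Q$ and $a$ over rational numbers. Conditional probability is given by the ratio formula $\Pr(\varphi\mid\psi)=\Pr(\varphi\wedge\psi)/\Pr(\psi)$ when $\Pr(\psi)\ne0$. As $\mathrm{RV}$ is added as an axiom, the Necessitation rule applies to all theorems of the extended system. *)

theory Defs
  imports Complex_Main
begin

section \<open>The language\<close>

text \<open>
  Terms and formulas with de Bruijn indices. The language of \<open>Q\<^sup>-\<close> is that of ordered fields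
  (with a total inverse, \<open>Inv 0 = 0\<close>) together with the predicate \<open>Nat\<close>; formulas without
  \<open>Prob\<close> are the formulas of \<open>Q\<^sup>-\<close>.
\<close>

datatype tm =
    Var nat
  | Zero
  | One
  | Add tm tm (infixl "\<oplus>" 75)
  | Mul tm tm (infixl "\<otimes>" 80)
  | Minus tm
  | Inv tm

datatype fm =
    Eq tm tm (infix "\<approx>" 70)
  | Less tm tm (infix "\<prec>" 70)
  | Nat tm
  | Prob tm tm
  | Neg fm ("\<^bold>\<not> _" [68] 68)
  | Conj fm fm (infixr "\<^bold>\<and>" 65)
  | Disj fm fm (infixr "\<^bold>\<or>" 60)
  | All fm

abbreviation Imp :: "fm \<Rightarrow> fm \<Rightarrow> fm" (infixr "\<^bold>\<longrightarrow>" 55)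
  where "\<phi> \<^bold>\<longrightarrow> \<psi> \<equiv> \<^bold>\<not> \<phi> \<^bold>\<or> \<psi>"

abbreviation Iff :: "fm \<Rightarrow> fm \<Rightarrow> fm" (infix "\<^bold>\<longleftrightarrow>" 55)
  where "\<phi> \<^bold>\<longleftrightarrow> \<psi> \<equiv> (\<phi> \<^bold>\<longrightarrow> \<psi>) \<^bold>\<and> (\<psi> \<^bold>\<longrightarrow> \<phi>)"

abbreviation Ex :: "fm \<Rightarrow> fm"
  where "Ex \<phi> \<equiv> \<^bold>\<not> (All (\<^bold>\<not> \<phi>))"

abbreviation Leq :: "tm \<Rightarrow> tm \<Rightarrow> fm" (infix "\<preceq>" 70)
  where "s \<preceq> t \<equiv> s \<prec> t \<^bold>\<or> s \<approx> t"

abbreviation AllN :: "fm \<Rightarrow> fm"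
  where "AllN \<phi> \<equiv> All (Nat (Var 0) \<^bold>\<longrightarrow> \<phi>)"

abbreviation ExN :: "fm \<Rightarrow> fm"
  where "ExN \<phi> \<equiv> Ex (Nat (Var 0) \<^bold>\<and> \<phi>)"

primrec closed_tm :: "nat \<Rightarrow> tm \<Rightarrow> bool" where
  "closed_tm n (Var i) \<longleftrightarrow> i < n"
| "closed_tm n Zero \<longleftrightarrow> True"
| "closed_tm n One \<longleftrightarrow> True"
| "closed_tm n (s \<oplus> t) \<longleftrightarrow> closed_tm n s \<and> closed_tm n t"
| "closed_tm n (s \<otimes> t) \<longleftrightarrow> closed_tm n s \<and> closed_tm n t"
| "closed_tm n (Minus t) \<longleftrightarrow> closed_tm n t"
| "closed_tm n (Inv t) \<longleftrightarrow> closed_tm n t"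

primrec closed_fm :: "nat \<Rightarrow> fm \<Rightarrow> bool" where
  "closed_fm n (s \<approx> t) \<longleftrightarrow> closed_tm n s \<and> closed_tm n t"
| "closed_fm n (s \<prec> t) \<longleftrightarrow> closed_tm n s \<and> closed_tm n t"
| "closed_fm n (Nat t) \<longleftrightarrow> closed_tm n t"
| "closed_fm n (Prob s t) \<longleftrightarrow> closed_tm n s \<and> closed_tm n t"
| "closed_fm n (\<^bold>\<not> \<phi>) \<longleftrightarrow> closed_fm n \<phi>"
| "closed_fm n (\<phi> \<^bold>\<and> \<psi>) \<longleftrightarrow> closed_fm n \<phi> \<and> closed_fm n \<psi>"
| "closed_fm n (\<phi> \<^bold>\<or> \<psi>) \<longleftrightarrow> closed_fm n \<phi> \<and> closed_fm n \<psi>"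
| "closed_fm n (All \<phi>) \<longleftrightarrow> closed_fm (Suc n) \<phi>"

definition sentence :: "fm \<Rightarrow> bool"
  where "sentence \<phi> \<longleftrightarrow> closed_fm 0 \<phi>"

primrec prob_free :: "fm \<Rightarrow> bool" where
  "prob_free (s \<approx> t) \<longleftrightarrow> True"
| "prob_free (s \<prec> t) \<longleftrightarrow> True"
| "prob_free (Nat t) \<longleftrightarrow> True"
| "prob_free (Prob s t) \<longleftrightarrow> False"
| "prob_free (\<^bold>\<not> \<phi>) \<longleftrightarrow> prob_free \<phi>"
| "prob_free (\<phi> \<^bold>\<and> \<psi>) \<longleftrightarrow> prob_free \<phi> \<and> prob_free \<psi>"
| "prob_free (\<phi> \<^bold>\<or> \<psi>) \<longleftrightarrow> prob_free \<phi> \<and> prob_free \<psi>"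
| "prob_free (All \<phi>) \<longleftrightarrow> prob_free \<phi>"

primrec lift_tm :: "nat \<Rightarrow> tm \<Rightarrow> tm" where
  "lift_tm k (Var i) = Var (if i < k then i else Suc i)"
| "lift_tm k Zero = Zero"
| "lift_tm k One = One"
| "lift_tm k (s \<oplus> t) = lift_tm k s \<oplus> lift_tm k t"
| "lift_tm k (s \<otimes> t) = lift_tm k s \<otimes> lift_tm k t"
| "lift_tm k (Minus t) = Minus (lift_tm k t)"
| "lift_tm k (Inv t) = Inv (lift_tm k t)"

primrec lift_fm :: "nat \<Rightarrow> fm \<Rightarrow> fm" where
  "lift_fm k (s \<approx> t) = lift_tm k s \<approx> lift_tm k t"
| "lift_fm k (s \<prec> t) = lift_tm k s \<prec> lift_tm k t"
| "lift_fm k (Nat t) = Nat (lift_tm k t)"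
| "lift_fm k (Prob s t) = Prob (lift_tm k s) (lift_tm k t)"
| "lift_fm k (\<^bold>\<not> \<phi>) = \<^bold>\<not> lift_fm k \<phi>"
| "lift_fm k (\<phi> \<^bold>\<and> \<psi>) = lift_fm k \<phi> \<^bold>\<and> lift_fm k \<psi>"
| "lift_fm k (\<phi> \<^bold>\<or> \<psi>) = lift_fm k \<phi> \<^bold>\<or> lift_fm k \<psi>"
| "lift_fm k (All \<phi>) = All (lift_fm (Suc k) \<phi>)"

primrec subst_tm :: "tm \<Rightarrow> nat \<Rightarrow> tm \<Rightarrow> tm" where
  "subst_tm (Var i) k u = (if i < k then Var i else if i = k then u else Var (i - 1))"
| "subst_tm Zero k u = Zero"
| "subst_tm One k u = One"
| "subst_tm (s \<oplus> t) k u = subst_tm s k u \<oplus> subst_tm t k u"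
| "subst_tm (s \<otimes> t) k u = subst_tm s k u \<otimes> subst_tm t k u"
| "subst_tm (Minus t) k u = Minus (subst_tm t k u)"
| "subst_tm (Inv t) k u = Inv (subst_tm t k u)"

primrec subst_fm :: "fm \<Rightarrow> nat \<Rightarrow> tm \<Rightarrow> fm" where
  "subst_fm (s \<approx> t) k u = (subst_tm s k u \<approx> subst_tm t k u)"
| "subst_fm (s \<prec> t) k u = (subst_tm s k u \<prec> subst_tm t k u)"
| "subst_fm (Nat t) k u = Nat (subst_tm t k u)"
| "subst_fm (Prob s t) k u = Prob (subst_tm s k u) (subst_tm t k u)"
| "subst_fm (\<^bold>\<not> \<phi>) k u = (\<^bold>\<not> subst_fm \<phi> k u)"
| "subst_fm (\<phi> \<^bold>\<and> \<psi>) k u = (subst_fm \<phi> k u \<^bold>\<and> subst_fm \<psi> k u)"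
| "subst_fm (\<phi> \<^bold>\<or> \<psi>) k u = (subst_fm \<phi> k u \<^bold>\<or> subst_fm \<psi> k u)"
| "subst_fm (All \<phi>) k u = All (subst_fm \<phi> (Suc k) (lift_tm 0 u))"

text \<open>Closed terms naming the natural numbers, the integers and the rationals.\<close>

primrec num :: "nat \<Rightarrow> tm" where
  "num 0 = Zero"
| "num (Suc n) = num n \<oplus> One"

definition int_tm :: "int \<Rightarrow> tm"
  where "int_tm i = (if 0 \<le> i then num (nat i) else Minus (num (nat (- i))))"

definition rat_tm :: "rat \<Rightarrow> tm"
  where "rat_tm a = int_tm (fst (quotient_of a)) \<otimes> Inv (int_tm (snd (quotient_of a)))"


section \<open>Coding\<close>

text \<open>
  An injective polynomial pairing, so that the syntactic operations on codes are given by terms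
  of the language: \<open>pair_tm\<close> is \<open>pair\<close> written in the object language.
\<close>

definition pair :: "nat \<Rightarrow> nat \<Rightarrow> nat"
  where "pair m n = (m + n) * (m + n) + m"

definition pair_tm :: "tm \<Rightarrow> tm \<Rightarrow> tm"
  where "pair_tm s t = (s \<oplus> t) \<otimes> (s \<oplus> t) \<oplus> s"

primrec code_tm :: "tm \<Rightarrow> nat" where
  "code_tm (Var i) = pair 1 i"
| "code_tm Zero = pair 2 0"
| "code_tm One = pair 3 0"
| "code_tm (s \<oplus> t) = pair 4 (pair (code_tm s) (code_tm t))"
| "code_tm (s \<otimes> t) = pair 5 (pair (code_tm s) (code_tm t))"
| "code_tm (Minus t) = pair 6 (code_tm t)"
| "code_tm (Inv t) = pair 7 (code_tm t)"

primrec code_fm :: "fm \<Rightarrow> nat" where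
  "code_fm (s \<approx> t) = pair 8 (pair (code_tm s) (code_tm t))"
| "code_fm (s \<prec> t) = pair 9 (pair (code_tm s) (code_tm t))"
| "code_fm (Nat t) = pair 10 (code_tm t)"
| "code_fm (Prob s t) = pair 11 (pair (code_tm s) (code_tm t))"
| "code_fm (\<^bold>\<not> \<phi>) = pair 12 (code_fm \<phi>)"
| "code_fm (\<phi> \<^bold>\<and> \<psi>) = pair 13 (pair (code_fm \<phi>) (code_fm \<psi>))"
| "code_fm (\<phi> \<^bold>\<or> \<psi>) = pair 14 (pair (code_fm \<phi>) (code_fm \<psi>))"
| "code_fm (All \<phi>) = pair 15 (code_fm \<phi>)"

definition quot :: "fm \<Rightarrow> tm" ("\<lceil>_\<rceil>")
  where "\<lceil>\<phi>\<rceil> = num (code_fm \<phi>)"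

text \<open>
  The syntactic operations on codes, as object-language terms. The argument \<open>j\<close> is the tag that
  \<open>code_tm\<close> or \<open>code_fm\<close> gives to the constructor.
\<close>

definition op1 :: "nat \<Rightarrow> tm \<Rightarrow> tm"
  where "op1 j s = pair_tm (num j) s"

definition op2 :: "nat \<Rightarrow> tm \<Rightarrow> tm \<Rightarrow> tm"
  where "op2 j s t = pair_tm (num j) (pair_tm s t)"

abbreviation neg_dot :: "tm \<Rightarrow> tm" where "neg_dot \<equiv> op1 12"
abbreviation conj_dot :: "tm \<Rightarrow> tm \<Rightarrow> tm" where "conj_dot \<equiv> op2 13"
abbreviation disj_dot :: "tm \<Rightarrow> tm \<Rightarrow> tm" where "disj_dot \<equiv> op2 14"

text \<open>
  \<open>subst_dot \<phi> k \<tau>\<close> is the code of the result of substituting in \<open>\<phi>\<close> for variable \<open>k\<close> the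
  closed term whose code is denoted by \<open>\<tau>\<close>. Here \<open>\<tau>\<close> may contain variables, and \<open>\<phi>\<close> has no
  free variables above \<open>k\<close>. As the substituted terms are closed, they need no lifting under
  quantifiers.
\<close>

primrec subst_dot_tm :: "tm \<Rightarrow> nat \<Rightarrow> tm \<Rightarrow> tm" where
  "subst_dot_tm (Var i) k \<tau> = (if i = k then \<tau> else op1 1 (num i))"
| "subst_dot_tm Zero k \<tau> = op1 2 Zero"
| "subst_dot_tm One k \<tau> = op1 3 Zero"
| "subst_dot_tm (s \<oplus> t) k \<tau> = op2 4 (subst_dot_tm s k \<tau>) (subst_dot_tm t k \<tau>)"
| "subst_dot_tm (s \<otimes> t) k \<tau> = op2 5 (subst_dot_tm s k \<tau>) (subst_dot_tm t k \<tau>)"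
| "subst_dot_tm (Minus t) k \<tau> = op1 6 (subst_dot_tm t k \<tau>)"
| "subst_dot_tm (Inv t) k \<tau> = op1 7 (subst_dot_tm t k \<tau>)"

primrec subst_dot :: "fm \<Rightarrow> nat \<Rightarrow> tm \<Rightarrow> tm" where
  "subst_dot (s \<approx> t) k \<tau> = op2 8 (subst_dot_tm s k \<tau>) (subst_dot_tm t k \<tau>)"
| "subst_dot (s \<prec> t) k \<tau> = op2 9 (subst_dot_tm s k \<tau>) (subst_dot_tm t k \<tau>)"
| "subst_dot (Nat t) k \<tau> = op1 10 (subst_dot_tm t k \<tau>)"
| "subst_dot (Prob s t) k \<tau> = op2 11 (subst_dot_tm s k \<tau>) (subst_dot_tm t k \<tau>)"
| "subst_dot (\<^bold>\<not> \<phi>) k \<tau> = op1 12 (subst_dot \<phi> k \<tau>)"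
| "subst_dot (\<phi> \<^bold>\<and> \<psi>) k \<tau> = op2 13 (subst_dot \<phi> k \<tau>) (subst_dot \<psi> k \<tau>)"
| "subst_dot (\<phi> \<^bold>\<or> \<psi>) k \<tau> = op2 14 (subst_dot \<phi> k \<tau>) (subst_dot \<psi> k \<tau>)"
| "subst_dot (All \<phi>) k \<tau> = op1 15 (subst_dot \<phi> (Suc k) \<tau>)"


section \<open>Arithmetized syntax\<close>

abbreviation lifts :: "nat \<Rightarrow> tm \<Rightarrow> tm"
  where "lifts n t \<equiv> (lift_tm 0 ^^ n) t"

text \<open>
  Finite sets of natural numbers are coded by triples \<open>(b, c, d)\<close>: the number \<open>x\<close> belongs to the
  set coded by \<open>(b, c, d)\<close> iff \<open>x < b\<close> and \<open>1 + (x + 1) d\<close> divides \<open>c\<close>. (If \<open>d\<close> is a multiple of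
  \<open>b!\<close>, the moduli for \<open>x < b\<close> are pairwise coprime, so every finite set has a code.)
  \<open>mem j x\<close> says that \<open>x\<close> belongs to the set coded by the variables \<open>j + 2\<close>, \<open>j + 1\<close>, \<open>j\<close>.
\<close>

definition mem :: "nat \<Rightarrow> tm \<Rightarrow> fm"
  where "mem j x =
    (Nat x \<^bold>\<and> x \<prec> Var (j + 2) \<^bold>\<and>
     ExN (Var 0 \<preceq> Var (j + 2) \<^bold>\<and>
       Var 0 \<otimes> (One \<oplus> (lifts 1 x \<oplus> One) \<otimes> Var (j + 1)) \<approx> Var (j + 2)))"

text \<open>
  \<open>tm_code t n\<close> says that \<open>t\<close> codes a term all of whose variables are below \<open>n\<close>: the pair
  \<open>(t, n)\<close> lies in a finite set of pairs each of which is justified by the formation rules from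
  pairs in the set. Codes of immediate subterms are strictly smaller, so such a set contains only
  correct pairs. In \<open>tm_rule\<close>, the pair is variable 0 and the set is given by the next three
  variables; after the first line, variable 1 is the term code and variable 0 the bound.
\<close>

definition tm_rule :: fm
  where "tm_rule =
    ExN (ExN (Var 2 \<approx> pair_tm (Var 1) (Var 0) \<^bold>\<and>
     (ExN (Var 0 \<prec> Var 1 \<^bold>\<and> Var 2 \<approx> op1 1 (Var 0))
    \<^bold>\<or> Var 1 \<approx> op1 2 Zero
    \<^bold>\<or> Var 1 \<approx> op1 3 Zero
    \<^bold>\<or> ExN (ExN (mem 5 (pair_tm (Var 1) (Var 2)) \<^bold>\<and> mem 5 (pair_tm (Var 0) (Var 2)) \<^bold>\<and>
        (Var 3 \<approx> op2 4 (Var 1) (Var 0) \<^bold>\<or> Var 3 \<approx> op2 5 (Var 1) (Var 0))))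
    \<^bold>\<or> ExN (mem 4 (pair_tm (Var 0) (Var 1)) \<^bold>\<and>
        (Var 2 \<approx> op1 6 (Var 0) \<^bold>\<or> Var 2 \<approx> op1 7 (Var 0))))))"

definition tm_code :: "tm \<Rightarrow> tm \<Rightarrow> fm"
  where "tm_code t n =
    (Nat t \<^bold>\<and> Nat n \<^bold>\<and>
     ExN (ExN (ExN (mem 0 (pair_tm (lifts 3 t) (lifts 3 n)) \<^bold>\<and> AllN (mem 1 (Var 0) \<^bold>\<longrightarrow> tm_rule)))))"

text \<open>The same for formulas; passing under a quantifier increases the bound by one.\<close>

definition fm_rule :: fm
  where "fm_rule =
    ExN (ExN (Var 2 \<approx> pair_tm (Var 1) (Var 0) \<^bold>\<and>
     (ExN (ExN (tm_code (Var 1) (Var 2) \<^bold>\<and> tm_code (Var 0) (Var 2) \<^bold>\<and>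
        (Var 3 \<approx> op2 8 (Var 1) (Var 0) \<^bold>\<or> Var 3 \<approx> op2 9 (Var 1) (Var 0)
          \<^bold>\<or> Var 3 \<approx> op2 11 (Var 1) (Var 0))))
    \<^bold>\<or> ExN (tm_code (Var 0) (Var 1) \<^bold>\<and> Var 2 \<approx> op1 10 (Var 0))
    \<^bold>\<or> ExN (mem 4 (pair_tm (Var 0) (Var 1)) \<^bold>\<and> Var 2 \<approx> op1 12 (Var 0))
    \<^bold>\<or> ExN (ExN (mem 5 (pair_tm (Var 1) (Var 2)) \<^bold>\<and> mem 5 (pair_tm (Var 0) (Var 2)) \<^bold>\<and>
        (Var 3 \<approx> op2 13 (Var 1) (Var 0) \<^bold>\<or> Var 3 \<approx> op2 14 (Var 1) (Var 0))))
    \<^bold>\<or> ExN (mem 4 (pair_tm (Var 0) (Var 1 \<oplus> One)) \<^bold>\<and> Var 2 \<approx> op1 15 (Var 0)))))"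

definition fm_code :: "tm \<Rightarrow> tm \<Rightarrow> fm"
  where "fm_code x n =
    (Nat x \<^bold>\<and> Nat n \<^bold>\<and>
     ExN (ExN (ExN (mem 0 (pair_tm (lifts 3 x) (lifts 3 n)) \<^bold>\<and> AllN (mem 1 (Var 0) \<^bold>\<longrightarrow> fm_rule)))))"

definition sent :: "tm \<Rightarrow> fm"
  where "sent x = fm_code x Zero"

definition const_tm :: "tm \<Rightarrow> fm"
  where "const_tm t = tm_code t Zero"

text \<open>
  Values of closed terms. A rational number is coded by \<open>(p, (q, r))\<close>, standing for
  \<open>(p - q) / r\<close>; \<open>frac f y\<close> says that \<open>f\<close> codes \<open>y\<close> in this way. \<open>value_of t y\<close> says that there is
  a finite set of pairs (term code, rational code), closed under the evaluation rules read
  backwards, that assigns \<open>y\<close> to \<open>t\<close>. In \<open>val_rule\<close>, after the first line variable 1 is the term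
  code and variable 0 the code of its value; then come a subterm, the code of its value and the
  value itself (variables 2, 1, 0 or, for a left subterm, 5, 4, 3).
\<close>

definition frac :: "tm \<Rightarrow> tm \<Rightarrow> fm"
  where "frac f y =
    ExN (ExN (ExN (lifts 3 f \<approx> pair_tm (Var 2) (pair_tm (Var 1) (Var 0)) \<^bold>\<and>
      lifts 3 y \<approx> (Var 2 \<oplus> Minus (Var 1)) \<otimes> Inv (Var 0))))"

definition val_rule :: fm
  where "val_rule =
    ExN (ExN (Var 2 \<approx> pair_tm (Var 1) (Var 0) \<^bold>\<and>
     (Var 1 \<approx> op1 2 Zero \<^bold>\<and> frac (Var 0) Zero
    \<^bold>\<or> Var 1 \<approx> op1 3 Zero \<^bold>\<and> frac (Var 0) One
    \<^bold>\<or> ExN (ExN (Ex (ExN (ExN (Ex (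
        mem 9 (pair_tm (Var 5) (Var 4)) \<^bold>\<and> frac (Var 4) (Var 3) \<^bold>\<and>
        mem 9 (pair_tm (Var 2) (Var 1)) \<^bold>\<and> frac (Var 1) (Var 0) \<^bold>\<and>
        (Var 7 \<approx> op2 4 (Var 5) (Var 2) \<^bold>\<and> frac (Var 6) (Var 3 \<oplus> Var 0)
         \<^bold>\<or> Var 7 \<approx> op2 5 (Var 5) (Var 2) \<^bold>\<and> frac (Var 6) (Var 3 \<otimes> Var 0))))))))
    \<^bold>\<or> ExN (ExN (Ex (
        mem 6 (pair_tm (Var 2) (Var 1)) \<^bold>\<and> frac (Var 1) (Var 0) \<^bold>\<and>
        (Var 4 \<approx> op1 6 (Var 2) \<^bold>\<and> frac (Var 3) (Minus (Var 0))
         \<^bold>\<or> Var 4 \<approx> op1 7 (Var 2) \<^bold>\<and> frac (Var 3) (Inv (Var 0)))))))))"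

definition value_of :: "tm \<Rightarrow> tm \<Rightarrow> fm"
  where "value_of t y =
    (Nat t \<^bold>\<and>
     ExN (ExN (ExN (
       ExN (mem 1 (pair_tm (lifts 4 t) (Var 0)) \<^bold>\<and> frac (Var 0) (lifts 4 y)) \<^bold>\<and>
       AllN (mem 1 (Var 0) \<^bold>\<longrightarrow> val_rule)))))"


section \<open>Derivability\<close>

text \<open>Truth-functional evaluation, with atomic and quantified formulas as prime formulas.\<close>

fun truth :: "(fm \<Rightarrow> bool) \<Rightarrow> fm \<Rightarrow> bool" where
  "truth e (\<^bold>\<not> \<phi>) \<longleftrightarrow> \<not> truth e \<phi>"
| "truth e (\<phi> \<^bold>\<and> \<psi>) \<longleftrightarrow> truth e \<phi> \<and> truth e \<psi>"
| "truth e (\<phi> \<^bold>\<or> \<psi>) \<longleftrightarrow> truth e \<phi> \<or> truth e \<psi>"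
| "truth e \<phi> \<longleftrightarrow> e \<phi>"

definition tautology :: "fm \<Rightarrow> bool"
  where "tautology \<phi> \<longleftrightarrow> (\<forall>e. truth e \<phi>)"

text \<open>
  Classical first-order logic with equality over the axioms \<open>A\<close>, closed under Necessitation.
  All formulas, including those with \<open>Prob\<close>, may occur in the logical axioms. Since \<open>Pr\<close> only
  applies to sentences, Necessitation is restricted to them; free variables can be removed with
  \<open>gen\<close>.
\<close>

inductive derivable :: "fm set \<Rightarrow> fm \<Rightarrow> bool" (infix "\<turnstile>" 50) for A :: "fm set" where
  ax: "\<phi> \<in> A \<Longrightarrow> A \<turnstile> \<phi>"
| taut: "tautology \<phi> \<Longrightarrow> A \<turnstile> \<phi>"
| inst: "A \<turnstile> All \<phi> \<^bold>\<longrightarrow> subst_fm \<phi> 0 t"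
| dist: "A \<turnstile> All (\<phi> \<^bold>\<longrightarrow> \<psi>) \<^bold>\<longrightarrow> All \<phi> \<^bold>\<longrightarrow> All \<psi>"
| vac: "A \<turnstile> \<phi> \<^bold>\<longrightarrow> All (lift_fm 0 \<phi>)"
| eq_refl: "A \<turnstile> t \<approx> t"
| eq_subst: "A \<turnstile> s \<approx> t \<^bold>\<longrightarrow> subst_fm \<phi> 0 s \<^bold>\<longrightarrow> subst_fm \<phi> 0 t"
| mp: "A \<turnstile> \<phi> \<^bold>\<longrightarrow> \<psi> \<Longrightarrow> A \<turnstile> \<phi> \<Longrightarrow> A \<turnstile> \<psi>"
| gen: "A \<turnstile> \<phi> \<Longrightarrow> A \<turnstile> All \<phi>"
| nec: "sentence \<phi> \<Longrightarrow> A \<turnstile> \<phi> \<Longrightarrow> A \<turnstile> Prob \<lceil>\<phi>\<rceil> One"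

definition inconsistent :: "fm set \<Rightarrow> bool"
  where "inconsistent A \<longleftrightarrow> (\<exists>\<phi>. A \<turnstile> \<phi> \<and> A \<turnstile> \<^bold>\<not> \<phi>)"


section \<open>The theories\<close>

abbreviation (input) "x0 \<equiv> Var 0"
abbreviation (input) "x1 \<equiv> Var 1"
abbreviation (input) "x2 \<equiv> Var 2"
abbreviation (input) "x3 \<equiv> Var 3"
abbreviation (input) "x4 \<equiv> Var 4"
abbreviation (input) "x5 \<equiv> Var 5"

definition ordered_field_axioms :: "fm set"
  where "ordered_field_axioms = {
    (x0 \<oplus> x1) \<oplus> x2 \<approx> x0 \<oplus> (x1 \<oplus> x2),
    x0 \<oplus> x1 \<approx> x1 \<oplus> x0,
    x0 \<oplus> Zero \<approx> x0,
    x0 \<oplus> Minus x0 \<approx> Zero,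
    (x0 \<otimes> x1) \<otimes> x2 \<approx> x0 \<otimes> (x1 \<otimes> x2),
    x0 \<otimes> x1 \<approx> x1 \<otimes> x0,
    x0 \<otimes> One \<approx> x0,
    x0 \<otimes> (x1 \<oplus> x2) \<approx> x0 \<otimes> x1 \<oplus> x0 \<otimes> x2,
    \<^bold>\<not> Zero \<approx> One,
    \<^bold>\<not> x0 \<approx> Zero \<^bold>\<longrightarrow> x0 \<otimes> Inv x0 \<approx> One,
    Inv Zero \<approx> Zero,
    \<^bold>\<not> x0 \<prec> x0,
    x0 \<prec> x1 \<^bold>\<and> x1 \<prec> x2 \<^bold>\<longrightarrow> x0 \<prec> x2,
    x0 \<prec> x1 \<^bold>\<or> x0 \<approx> x1 \<^bold>\<or> x1 \<prec> x0,
    x0 \<prec> x1 \<^bold>\<longrightarrow> x0 \<oplus> x2 \<prec> x1 \<oplus> x2,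
    Zero \<prec> x0 \<^bold>\<and> Zero \<prec> x1 \<^bold>\<longrightarrow> Zero \<prec> x0 \<otimes> x1}"

text \<open>
  Induction on variable 0; the other variables are parameters. Lifting above 0 before substituting
  \<open>x + 1\<close> keeps the parameters in place.
\<close>

definition induction :: "fm \<Rightarrow> fm"
  where "induction \<phi> =
    (subst_fm \<phi> 0 Zero \<^bold>\<and> AllN (\<phi> \<^bold>\<longrightarrow> subst_fm (lift_fm 1 \<phi>) 0 (x0 \<oplus> One)) \<^bold>\<longrightarrow> AllN \<phi>)"

text \<open>
  The Peano axioms relativized to \<open>Nat\<close>. Several of them already follow from the field axioms.
\<close>

definition peano_axioms :: "fm set"
  where "peano_axioms = {
    Nat Zero,
    Nat x0 \<^bold>\<longrightarrow> Nat (x0 \<oplus> One),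
    Nat x0 \<^bold>\<and> Nat x1 \<^bold>\<longrightarrow> Nat (x0 \<oplus> x1),
    Nat x0 \<^bold>\<and> Nat x1 \<^bold>\<longrightarrow> Nat (x0 \<otimes> x1),
    Nat x0 \<^bold>\<longrightarrow> \<^bold>\<not> x0 \<oplus> One \<approx> Zero,
    Nat x0 \<^bold>\<and> Nat x1 \<^bold>\<and> x0 \<oplus> One \<approx> x1 \<oplus> One \<^bold>\<longrightarrow> x0 \<approx> x1,
    Nat x0 \<^bold>\<longrightarrow> x0 \<oplus> Zero \<approx> x0,
    Nat x0 \<^bold>\<and> Nat x1 \<^bold>\<longrightarrow> x0 \<oplus> (x1 \<oplus> One) \<approx> (x0 \<oplus> x1) \<oplus> One,
    Nat x0 \<^bold>\<longrightarrow> x0 \<otimes> Zero \<approx> Zero,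
    Nat x0 \<^bold>\<and> Nat x1 \<^bold>\<longrightarrow> x0 \<otimes> (x1 \<oplus> One) \<approx> x0 \<otimes> x1 \<oplus> x0}"

text \<open>Every element is a quotient of integers.\<close>

definition fraction_axiom :: fm
  where "fraction_axiom =
    ExN (ExN (\<^bold>\<not> x0 \<approx> Zero \<^bold>\<and> (x2 \<otimes> x0 \<approx> x1 \<^bold>\<or> x2 \<otimes> x0 \<approx> Minus x1)))"

definition rational_axioms :: "fm set \<Rightarrow> fm set"
  where "rational_axioms L =
    ordered_field_axioms \<union> peano_axioms \<union> {fraction_axiom} \<union> induction ` L"

definition Q_minus :: "fm set"
  where "Q_minus = rational_axioms {\<phi>. prob_free \<phi>}"

definition Q_pr :: "fm set"
  where "Q_pr = rational_axioms UNIV"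

text \<open>
  Functional notation is eliminated in the usual way: a condition on \<open>Pr(x)\<close> says that some value
  \<open>p\<close> with \<open>Pr(x, p)\<close> satisfies it.
\<close>

definition pr_function :: "fm set"
  where "pr_function = {
    Prob x0 x1 \<^bold>\<and> Prob x0 x2 \<^bold>\<longrightarrow> x1 \<approx> x2,
    sent x0 \<^bold>\<longrightarrow> Ex (Prob x1 x0)}"

definition pr_range :: fm
  where "pr_range = (Prob x0 x1 \<^bold>\<longrightarrow> sent x0 \<^bold>\<and> Zero \<preceq> x1 \<^bold>\<and> x1 \<preceq> One)"

definition pr_true :: "fm \<Rightarrow> fm"
  where "pr_true \<phi> =
    AllN (const_tm x0 \<^bold>\<longrightarrow>
      (Prob (subst_dot \<phi> 0 x0) One \<^bold>\<longleftrightarrow> Ex (value_of x1 x0 \<^bold>\<and> \<phi>)))"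

definition pr_mono :: "fm set"
  where "pr_mono = {
    sent x0 \<^bold>\<and> sent x1 \<^bold>\<longrightarrow>
      Ex (Ex (Prob x2 x1 \<^bold>\<and> Prob (disj_dot x2 x3) x0 \<^bold>\<and> x1 \<preceq> x0)),
    sent x0 \<^bold>\<and> sent x1 \<^bold>\<longrightarrow>
      Ex (Ex (Prob x3 x1 \<^bold>\<and> Prob (disj_dot x2 x3) x0 \<^bold>\<and> x1 \<preceq> x0))}"

definition pr_disj :: fm
  where "pr_disj =
    (sent x0 \<^bold>\<and> sent x1 \<^bold>\<longrightarrow>
      Ex (Ex (Ex (Ex (Prob (disj_dot x4 x5) x3 \<^bold>\<and> Prob x4 x2 \<^bold>\<and> Prob x5 x1 \<^bold>\<and>
        Prob (conj_dot x4 x5) x0 \<^bold>\<and> x3 \<approx> (x2 \<oplus> x1) \<oplus> Minus x0)))))"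

definition pr_neg :: fm
  where "pr_neg =
    (sent x0 \<^bold>\<longrightarrow> Ex (Ex (Prob (neg_dot x2) x1 \<^bold>\<and> Prob x2 x0 \<^bold>\<and> x1 \<approx> One \<oplus> Minus x0)))"

text \<open>The Necessitation rule of \<open>RKf\<close> is part of \<open>derivable\<close>.\<close>

definition RKf :: "fm set"
  where "RKf = Q_pr \<union> pr_function \<union> {pr_range} \<union>
    {pr_true \<phi> | \<phi>. prob_free \<phi> \<and> closed_fm 1 \<phi>} \<union> pr_mono \<union> {pr_disj, pr_neg}"

definition RV_instance :: "fm \<Rightarrow> rat \<Rightarrow> fm"
  where "RV_instance \<phi> a =
    (let \<psi> = Prob \<lceil>\<phi>\<rceil> (rat_tm a) in
      Ex (Prob \<lceil>\<psi>\<rceil> x0 \<^bold>\<and> \<^bold>\<not> x0 \<approx> Zero) \<^bold>\<longrightarrow>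
      Ex (Ex (Prob \<lceil>\<phi> \<^bold>\<and> \<psi>\<rceil> x1 \<^bold>\<and> Prob \<lceil>\<psi>\<rceil> x0 \<^bold>\<and> x1 \<otimes> Inv x0 \<approx> rat_tm a)))"

definition RV :: "fm set"
  where "RV = {RV_instance \<phi> a | \<phi> a. sentence \<phi>}"

end

theory Submission
  imports Defs "HOL-Library.Countable_Set"
begin

text \<open>
  Let \<open>\<lambda>\<close> be a sentence provably equivalent to \<open>\<not> \<psi>\<close>, where \<open>\<psi>\<close> is \<open>Pr(\<lambda>) = 1\<close>. By Necessitation,
  \<open>\<lambda> \<and> \<psi>\<close> has probability 0 and \<open>\<lambda> \<or> \<psi>\<close> has probability 1. If \<open>Pr(\<psi>)\<close> were not 0, then RV with
  \<open>a = 1\<close> would give \<open>Pr(\<lambda> \<and> \<psi>) / Pr(\<psi>) = 1\<close>; hence \<open>Pr(\<psi>) = 0\<close> and so \<open>Pr(\<lambda>) = 1\<close>. The latter is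
  \<open>\<psi>\<close> itself, so Necessitation also gives \<open>Pr(\<psi>) = 1\<close>.

  Derivations inside the theory are replaced by arguments about its models, using completeness of
  first-order logic. Closure under Necessitation is harmless there, since only the set of theorems
  matters. The probability axioms apply to codes that the theory proves to be sentences; this is
  first obtained for theorems, from Necessitation and the range axiom for \<open>Pr\<close>, and then passed on to
  subformulas.
\<close>

section \<open>Parallel substitution\<close>

definition up :: "(nat \<Rightarrow> tm) \<Rightarrow> nat \<Rightarrow> tm"
  where "up \<sigma> = case_nat (Var 0) (\<lambda>i. lift_tm 0 (\<sigma> i))"

primrec psubst_tm :: "(nat \<Rightarrow> tm) \<Rightarrow> tm \<Rightarrow> tm" where
  "psubst_tm \<sigma> (Var i) = \<sigma> i"
| "psubst_tm \<sigma> Zero = Zero"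
| "psubst_tm \<sigma> One = One"
| "psubst_tm \<sigma> (s \<oplus> t) = psubst_tm \<sigma> s \<oplus> psubst_tm \<sigma> t"
| "psubst_tm \<sigma> (s \<otimes> t) = psubst_tm \<sigma> s \<otimes> psubst_tm \<sigma> t"
| "psubst_tm \<sigma> (Minus t) = Minus (psubst_tm \<sigma> t)"
| "psubst_tm \<sigma> (Inv t) = Inv (psubst_tm \<sigma> t)"

text \<open>For formulas, \<open>lift_fm\<close> and \<open>subst_fm\<close> are both special cases,
  so one composition law and one semantic law replace separate commutation lemmas.\<close>

primrec psubst :: "(nat \<Rightarrow> tm) \<Rightarrow> fm \<Rightarrow> fm" where
  "psubst \<sigma> (s \<approx> t) = (psubst_tm \<sigma> s \<approx> psubst_tm \<sigma> t)"
| "psubst \<sigma> (s \<prec> t) = (psubst_tm \<sigma> s \<prec> psubst_tm \<sigma> t)"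
| "psubst \<sigma> (Nat t) = Nat (psubst_tm \<sigma> t)"
| "psubst \<sigma> (Prob s t) = Prob (psubst_tm \<sigma> s) (psubst_tm \<sigma> t)"
| "psubst \<sigma> (\<^bold>\<not> \<phi>) = (\<^bold>\<not> psubst \<sigma> \<phi>)"
| "psubst \<sigma> (\<phi> \<^bold>\<and> \<psi>) = (psubst \<sigma> \<phi> \<^bold>\<and> psubst \<sigma> \<psi>)"
| "psubst \<sigma> (\<phi> \<^bold>\<or> \<psi>) = (psubst \<sigma> \<phi> \<^bold>\<or> psubst \<sigma> \<psi>)"
| "psubst \<sigma> (All \<phi>) = All (psubst (up \<sigma>) \<phi>)"

lemma up_simps [simp]: "up \<sigma> 0 = Var 0" "up \<sigma> (Suc i) = lift_tm 0 (\<sigma> i)"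
  by (simp_all add: up_def)

lemma up_Var [simp]: "up Var = Var"
  by (auto simp: up_def fun_eq_iff split: nat.split)

lemma psubst_tm_Var [simp]: "psubst_tm Var t = t"
  by (induction t) auto

lemma psubst_Var [simp]: "psubst Var \<phi> = \<phi>"
  by (induction \<phi>) auto

lemma psubst_tm_cong: "closed_tm n t \<Longrightarrow> (\<And>i. i < n \<Longrightarrow> \<sigma> i = \<tau> i) \<Longrightarrow> psubst_tm \<sigma> t = psubst_tm \<tau> t"
  by (induction t) auto

lemma psubst_cong: "closed_fm n \<phi> \<Longrightarrow> (\<And>i. i < n \<Longrightarrow> \<sigma> i = \<tau> i) \<Longrightarrow> psubst \<sigma> \<phi> = psubst \<tau> \<phi>"
proof (induction \<phi> arbitrary: n \<sigma> \<tau>)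
  case (Conj \<phi> \<psi>)
  from Conj.prems show ?case using Conj.IH[of n \<sigma> \<tau>] by simp
next
  case (Disj \<phi> \<psi>)
  from Disj.prems show ?case using Disj.IH[of n \<sigma> \<tau>] by simp
next
  case (Neg \<phi>)
  from Neg.prems show ?case using Neg.IH[of n \<sigma> \<tau>] by simp
next
  case (All \<phi>)
  have "up \<sigma> i = up \<tau> i" if "i < Suc n" for i
    using that All.prems(2) by (cases i) auto
  then have "psubst (up \<sigma>) \<phi> = psubst (up \<tau>) \<phi>"
    using All.prems(1) by (intro All.IH) auto
  then show ?case by simp
qed (simp_all, (blast intro: psubst_tm_cong)+)

lemma lift_tm_psubst: "lift_tm k t = psubst_tm (\<lambda>i. Var (if i < k then i else Suc i)) t"
  by (induction t) auto

lemma up_lift: "up (\<lambda>i. Var (if i < k then i else Suc i)) = (\<lambda>i. Var (if i < Suc k then i else Suc i))"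
  by (auto simp: up_def fun_eq_iff split: nat.split)

lemma lift_fm_psubst: "lift_fm k \<phi> = psubst (\<lambda>i. Var (if i < k then i else Suc i)) \<phi>"
  by (induction \<phi> arbitrary: k) (simp_all add: lift_tm_psubst up_lift)

lemma subst_tm_psubst:
  "subst_tm t k u = psubst_tm (\<lambda>i. if i < k then Var i else if i = k then u else Var (i - 1)) t"
  by (induction t) auto

lemma up_subst:
  "up (\<lambda>i. if i < k then Var i else if i = k then u else Var (i - 1)) =
    (\<lambda>i. if i < Suc k then Var i else if i = Suc k then lift_tm 0 u else Var (i - 1))"
  by (auto simp: up_def fun_eq_iff split: nat.split)

lemma subst_fm_psubst:
  "subst_fm \<phi> k u = psubst (\<lambda>i. if i < k then Var i else if i = k then u else Var (i - 1)) \<phi>"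
  by (induction \<phi> arbitrary: k u) (simp_all add: subst_tm_psubst up_subst)

lemma psubst_tm_up_lift: "psubst_tm (up \<sigma>) (lift_tm 0 t) = lift_tm 0 (psubst_tm \<sigma> t)"
  by (induction t) auto

lemma psubst_tm_psubst_tm: "psubst_tm \<sigma> (psubst_tm \<tau> t) = psubst_tm (\<lambda>i. psubst_tm \<sigma> (\<tau> i)) t"
  by (induction t) auto

lemma up_comp: "(\<lambda>i. psubst_tm (up \<sigma>) (up \<tau> i)) = up (\<lambda>i. psubst_tm \<sigma> (\<tau> i))"
proof
  fix i show "psubst_tm (up \<sigma>) (up \<tau> i) = up (\<lambda>i. psubst_tm \<sigma> (\<tau> i)) i"
    by (cases i) (auto simp: psubst_tm_up_lift)
qed

lemma psubst_psubst: "psubst \<sigma> (psubst \<tau> \<phi>) = psubst (\<lambda>i. psubst_tm \<sigma> (\<tau> i)) \<phi>"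
  by (induction \<phi> arbitrary: \<sigma> \<tau>) (simp_all add: psubst_tm_psubst_tm up_comp)

section \<open>Bounds on free variables\<close>

lemma closed_tm_mono: "closed_tm n t \<Longrightarrow> n \<le> m \<Longrightarrow> closed_tm m t"
  by (induction t) auto

lemma closed_fm_mono: "closed_fm n \<phi> \<Longrightarrow> n \<le> m \<Longrightarrow> closed_fm m \<phi>"
  by (induction \<phi> arbitrary: n m) (auto intro: closed_tm_mono)

lemma ex_closed_tm: "\<exists>n. closed_tm n t"
proof (induction t)
  case (Var i) show ?case by (auto intro: exI[of _ "Suc i"])
next
  case (Add s t)
  then obtain m n where "closed_tm m s" "closed_tm n t" by auto
  then show ?case by (auto intro!: exI[of _ "max m n"] elim: closed_tm_mono)
next
  case (Mul s t)
  then obtain m n where "closed_tm m s" "closed_tm n t" by auto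
  then show ?case by (auto intro!: exI[of _ "max m n"] elim: closed_tm_mono)
qed auto

lemma ex_closed_tm2: "\<exists>n. closed_tm n s \<and> closed_tm n t"
  using ex_closed_tm[of "s \<oplus> t"] by simp

lemma ex_closed_fm: "\<exists>n. closed_fm n \<phi>"
proof (induction \<phi>)
  case (Conj \<phi> \<psi>)
  then obtain m n where "closed_fm m \<phi>" "closed_fm n \<psi>" by auto
  then show ?case by (auto intro!: exI[of _ "max m n"] elim: closed_fm_mono)
next
  case (Disj \<phi> \<psi>)
  then obtain m n where "closed_fm m \<phi>" "closed_fm n \<psi>" by auto
  then show ?case by (auto intro!: exI[of _ "max m n"] elim: closed_fm_mono)
next
  case (All \<phi>)
  then obtain n where "closed_fm n \<phi>" by auto
  then show ?case by (auto intro!: exI[of _ n] elim: closed_fm_mono)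
qed (auto simp: ex_closed_tm ex_closed_tm2)


section \<open>Derived rules\<close>

lemma taut_mp: "A \<turnstile> \<phi> \<Longrightarrow> tautology (\<phi> \<^bold>\<longrightarrow> \<psi>) \<Longrightarrow> A \<turnstile> \<psi>"
  by (meson mp taut)

lemma taut_mp2: "A \<turnstile> \<phi> \<Longrightarrow> A \<turnstile> \<chi> \<Longrightarrow> tautology (\<phi> \<^bold>\<longrightarrow> \<chi> \<^bold>\<longrightarrow> \<psi>) \<Longrightarrow> A \<turnstile> \<psi>"
  by (meson mp taut)

lemma imp_trans: "A \<turnstile> \<phi> \<^bold>\<longrightarrow> \<psi> \<Longrightarrow> A \<turnstile> \<psi> \<^bold>\<longrightarrow> \<chi> \<Longrightarrow> A \<turnstile> \<phi> \<^bold>\<longrightarrow> \<chi>"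
  by (erule (1) taut_mp2) (simp add: tautology_def)

lemma subst_All_pow: "subst_fm ((All ^^ n) \<phi>) k u = (All ^^ n) (subst_fm \<phi> (k + n) (lifts n u))"
  by (induction n arbitrary: k u) (simp_all add: funpow_swap1[of "lift_tm 0"])

lemma psubst_tm_lifts:
  "psubst_tm (\<lambda>i. if i < n then \<sigma> i else Var (i - n)) (lifts n u) = u"
proof -
  have "lifts n u = psubst_tm (\<lambda>i. Var (i + n)) u" for n
    by (induction n) (simp_all add: lift_tm_psubst psubst_tm_psubst_tm)
  then show ?thesis by (simp add: psubst_tm_psubst_tm)
qed

text \<open>The quantifiers are stripped from the outside, so variable \<open>n\<close> is replaced
  first. Its replacement is lifted past the remaining quantifiers, and
  \<open>psubst_tm_lifts\<close> shows that the later instantiations only undo this lifting; the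
  successive substitutions thus act as a simultaneous one.\<close>

lemma inst_All_pow:
  "A \<turnstile> (All ^^ n) \<phi> \<Longrightarrow> A \<turnstile> psubst (\<lambda>i. if i < n then \<sigma> i else Var (i - n)) \<phi>"
proof (induction n arbitrary: \<phi>)
  case 0 then show ?case by simp
next
  case (Suc n)
  have "A \<turnstile> subst_fm ((All ^^ n) \<phi>) 0 (\<sigma> n)"
    using mp[OF inst] Suc.prems by simp
  then have "A \<turnstile> (All ^^ n) (subst_fm \<phi> n (lifts n (\<sigma> n)))"
    by (simp add: subst_All_pow)
  from Suc.IH[OF this] have "A \<turnstile> psubst (\<lambda>i. psubst_tm (\<lambda>i. if i < n then \<sigma> i else Var (i - n))
      (if i < n then Var i else if i = n then lifts n (\<sigma> n) else Var (i - 1))) \<phi>"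
    by (simp add: subst_fm_psubst psubst_psubst)
  moreover have "(\<lambda>i. psubst_tm (\<lambda>i. if i < n then \<sigma> i else Var (i - n))
      (if i < n then Var i else if i = n then lifts n (\<sigma> n) else Var (i - 1)))
      = (\<lambda>i. if i < Suc n then \<sigma> i else Var (i - Suc n))"
    by (auto simp: fun_eq_iff psubst_tm_lifts less_Suc_eq)
  ultimately show ?case by simp
qed

text \<open>With \<open>n\<close> bounding the free variables, \<open>n\<close> generalizations
  close the formula and \<open>inst_All_pow\<close> reopens it with arbitrary terms.\<close>

lemma derivable_psubst:
  assumes "A \<turnstile> \<phi>"
  shows "A \<turnstile> psubst \<sigma> \<phi>"
proof -
  obtain n where n: "closed_fm n \<phi>" using ex_closed_fm by blast
  have "A \<turnstile> (All ^^ m) \<phi>" for m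
    by (induction m) (auto intro: gen assms)
  then have "A \<turnstile> psubst (\<lambda>i. if i < n then \<sigma> i else Var (i - n)) \<phi>"
    by (rule inst_All_pow)
  moreover have "psubst (\<lambda>i. if i < n then \<sigma> i else Var (i - n)) \<phi> = psubst \<sigma> \<phi>"
    using n by (rule psubst_cong) simp
  ultimately show ?thesis by simp
qed

lemma gen_fresh:
  assumes "A \<turnstile> \<theta> \<^bold>\<longrightarrow> subst_fm \<phi> 0 (Var n)" "closed_fm n \<theta>" "closed_fm (Suc n) \<phi>"
  shows "A \<turnstile> \<theta> \<^bold>\<longrightarrow> All \<phi>"
proof -
  \<comment> \<open>This renaming moves the fresh variable \<open>n\<close> to index 0 and shifts
    the smaller ones up. The hypothesis becomes its lift and the instance becomes the matrix itself,
    so \<open>gen\<close> binds exactly the fresh variable.\<close>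
  define \<sigma> where "\<sigma> i = (if i < n then Var (Suc i) else Var 0)" for i
  have "A \<turnstile> psubst \<sigma> (\<theta> \<^bold>\<longrightarrow> subst_fm \<phi> 0 (Var n))"
    using assms(1) by (rule derivable_psubst)
  moreover have "psubst \<sigma> \<theta> = lift_fm 0 \<theta>"
    unfolding lift_fm_psubst using assms(2) by (rule psubst_cong) (simp add: \<sigma>_def)
  moreover have "psubst \<sigma> (subst_fm \<phi> 0 (Var n)) = psubst Var \<phi>"
    unfolding subst_fm_psubst psubst_psubst using assms(3) by (rule psubst_cong) (auto simp: \<sigma>_def)
  ultimately have "A \<turnstile> lift_fm 0 \<theta> \<^bold>\<longrightarrow> \<phi>" by simp
  then have "A \<turnstile> All (lift_fm 0 \<theta>) \<^bold>\<longrightarrow> All \<phi>"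
    by (meson gen dist mp)
  then show ?thesis using vac imp_trans by blast
qed


section \<open>Semantics\<close>

record 'a struct =
  zero_of :: 'a
  one_of :: 'a
  plus_of :: "'a \<Rightarrow> 'a \<Rightarrow> 'a"
  times_of :: "'a \<Rightarrow> 'a \<Rightarrow> 'a"
  minus_of :: "'a \<Rightarrow> 'a"
  inv_of :: "'a \<Rightarrow> 'a"
  less_of :: "'a \<Rightarrow> 'a \<Rightarrow> bool"
  nat_of :: "'a \<Rightarrow> bool"
  prob_of :: "'a \<Rightarrow> 'a \<Rightarrow> bool"

abbreviation push :: "'a \<Rightarrow> (nat \<Rightarrow> 'a) \<Rightarrow> nat \<Rightarrow> 'a" (infixr "##" 65)
  where "x ## e \<equiv> case_nat x e"

primrec eval_tm :: "'a struct \<Rightarrow> (nat \<Rightarrow> 'a) \<Rightarrow> tm \<Rightarrow> 'a" where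
  "eval_tm M e (Var i) = e i"
| "eval_tm M e Zero = zero_of M"
| "eval_tm M e One = one_of M"
| "eval_tm M e (s \<oplus> t) = plus_of M (eval_tm M e s) (eval_tm M e t)"
| "eval_tm M e (s \<otimes> t) = times_of M (eval_tm M e s) (eval_tm M e t)"
| "eval_tm M e (Minus t) = minus_of M (eval_tm M e t)"
| "eval_tm M e (Inv t) = inv_of M (eval_tm M e t)"

primrec sat :: "'a struct \<Rightarrow> (nat \<Rightarrow> 'a) \<Rightarrow> fm \<Rightarrow> bool" where
  "sat M e (s \<approx> t) \<longleftrightarrow> eval_tm M e s = eval_tm M e t"
| "sat M e (s \<prec> t) \<longleftrightarrow> less_of M (eval_tm M e s) (eval_tm M e t)"
| "sat M e (Nat t) \<longleftrightarrow> nat_of M (eval_tm M e t)"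
| "sat M e (Prob s t) \<longleftrightarrow> prob_of M (eval_tm M e s) (eval_tm M e t)"
| "sat M e (\<^bold>\<not> \<phi>) \<longleftrightarrow> \<not> sat M e \<phi>"
| "sat M e (\<phi> \<^bold>\<and> \<psi>) \<longleftrightarrow> sat M e \<phi> \<and> sat M e \<psi>"
| "sat M e (\<phi> \<^bold>\<or> \<psi>) \<longleftrightarrow> sat M e \<phi> \<or> sat M e \<psi>"
| "sat M e (All \<phi>) \<longleftrightarrow> (\<forall>x. sat M (x ## e) \<phi>)"

lemma eval_tm_psubst: "eval_tm M e (psubst_tm \<sigma> t) = eval_tm M (\<lambda>i. eval_tm M e (\<sigma> i)) t"
  by (induction t) auto

lemma eval_tm_lift [simp]: "eval_tm M (x ## e) (lift_tm 0 t) = eval_tm M e t"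
  by (induction t) auto

lemma eval_tm_up: "(\<lambda>i. eval_tm M (x ## e) (up \<sigma> i)) = x ## (\<lambda>i. eval_tm M e (\<sigma> i))"
proof
  fix i show "eval_tm M (x ## e) (up \<sigma> i) = (x ## (\<lambda>i. eval_tm M e (\<sigma> i))) i"
    by (cases i) auto
qed

lemma sat_psubst: "sat M e (psubst \<sigma> \<phi>) \<longleftrightarrow> sat M (\<lambda>i. eval_tm M e (\<sigma> i)) \<phi>"
  by (induction \<phi> arbitrary: e \<sigma>) (simp_all add: eval_tm_psubst eval_tm_up)

lemma sat_subst: "sat M e (subst_fm \<phi> 0 u) \<longleftrightarrow> sat M (eval_tm M e u ## e) \<phi>"
proof -
  have "(\<lambda>i. eval_tm M e (if i < 0 then Var i else if i = 0 then u else Var (i - 1)))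
    = eval_tm M e u ## e"
    by (auto simp: fun_eq_iff split: nat.split)
  then show ?thesis by (simp only: subst_fm_psubst sat_psubst)
qed

lemma sat_lift_1: "sat M (x ## y ## e) (lift_fm 1 \<phi>) \<longleftrightarrow> sat M (x ## e) \<phi>"
proof -
  have "(\<lambda>i. eval_tm M (x ## y ## e) (Var (if i < 1 then i else Suc i))) = x ## e"
    by (auto simp: fun_eq_iff split: nat.split)
  then show ?thesis by (simp only: lift_fm_psubst sat_psubst)
qed

text \<open>All theorems have to be true, not only the axioms: Necessitation need not preserve truth
  in a single structure, so a structure satisfying the axioms may falsify a theorem.\<close>

definition model :: "fm set \<Rightarrow> 'a struct \<Rightarrow> bool"
  where "model A M \<longleftrightarrow> (\<forall>\<phi> e. A \<turnstile> \<phi> \<longrightarrow> sat M e \<phi>)"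


section \<open>Completeness\<close>

text \<open>With s = m + n, the value of \<open>pair m n\<close> is at least s^2 and less than (s +
  1)^2; these intervals are disjoint for different sums.\<close>

lemma pair_less:
  assumes "m + n < m' + n'"
  shows "pair m n < pair m' n'"
proof -
  have "pair m n < Suc (m + n) * Suc (m + n)" by (simp add: pair_def)
  also have "\<dots> \<le> (m' + n') * (m' + n')" using assms by (intro mult_le_mono) auto
  also have "\<dots> \<le> pair m' n'" by (simp add: pair_def)
  finally show ?thesis .
qed

lemma pair_inject [simp]: "pair m n = pair m' n' \<longleftrightarrow> m = m' \<and> n = n'"
proof
  assume eq: "pair m n = pair m' n'"
  then have "m + n = m' + n'" using pair_less by (metis less_irrefl linorder_neqE_nat)
  with eq show "m = m' \<and> n = n'" by (simp add: pair_def)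
qed simp

lemma code_tm_inject [simp]: "code_tm s = code_tm t \<longleftrightarrow> s = t"
proof (induction s arbitrary: t)
  case (Var i) show ?case by (cases t) auto
next
  case Zero show ?case by (cases t) auto
next
  case One show ?case by (cases t) auto
next
  case (Add s1 s2) then show ?case by (cases t) auto
next
  case (Mul s1 s2) then show ?case by (cases t) auto
next
  case (Minus s) then show ?case by (cases t) auto
next
  case (Inv s) then show ?case by (cases t) auto
qed

lemma code_fm_inject [simp]: "code_fm \<phi> = code_fm \<psi> \<longleftrightarrow> \<phi> = \<psi>"
proof (induction \<phi> arbitrary: \<psi>)
  case (Eq s t) show ?case by (cases \<psi>) auto
next
  case (Less s t) show ?case by (cases \<psi>) auto
next
  case (Nat t) show ?case by (cases \<psi>) auto
next
  case (Prob s t) show ?case by (cases \<psi>) auto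
next
  case (Neg \<phi>) then show ?case by (cases \<psi>) auto
next
  case (Conj \<phi>1 \<phi>2) then show ?case by (cases \<psi>) auto
next
  case (Disj \<phi>1 \<phi>2) then show ?case by (cases \<psi>) auto
next
  case (All \<phi>) then show ?case by (cases \<psi>) auto
qed

instance tm :: countable
  by (rule countable_classI[of code_tm]) simp

instance fm :: countable
  by (rule countable_classI[of code_fm]) simp

lemma size_subst_fm [simp]: "size (subst_fm \<phi> k u) = size \<phi>"
  by (induction \<phi> arbitrary: k u) auto

text \<open>
  A single formula has only finitely many free variables, so fresh variables can serve as Henkin
  witnesses and the language need not be extended.
\<close>

lemma henkin_step:
  assumes cons: "\<not> A \<turnstile> \<^bold>\<not> \<theta>"
  shows "\<exists>\<theta>'. \<not> A \<turnstile> \<^bold>\<not> \<theta>' \<and> A \<turnstile> \<theta>' \<^bold>\<longrightarrow> \<theta> \<and> (A \<turnstile> \<theta>' \<^bold>\<longrightarrow> \<phi> \<or> A \<turnstile> \<theta>' \<^bold>\<longrightarrow> \<^bold>\<not> \<phi>) \<and>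
    (\<forall>\<chi>. \<phi> = All \<chi> \<longrightarrow> A \<turnstile> \<theta>' \<^bold>\<longrightarrow> \<phi> \<or> (\<exists>t. A \<turnstile> \<theta>' \<^bold>\<longrightarrow> \<^bold>\<not> subst_fm \<chi> 0 t))"
proof (cases "A \<turnstile> \<^bold>\<not> (\<theta> \<^bold>\<and> \<phi>)")
  case False
  then show ?thesis
    by (intro exI[of _ "\<theta> \<^bold>\<and> \<phi>"]) (auto intro!: taut simp: tautology_def)
next
  case True
  show ?thesis
  proof (cases "\<exists>\<chi>. \<phi> = All \<chi>")
    case False
    have "\<not> A \<turnstile> \<^bold>\<not> (\<theta> \<^bold>\<and> \<^bold>\<not> \<phi>)"
    proof
      assume "A \<turnstile> \<^bold>\<not> (\<theta> \<^bold>\<and> \<^bold>\<not> \<phi>)"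
      with True have "A \<turnstile> \<^bold>\<not> \<theta>" by (rule taut_mp2) (auto simp: tautology_def)
      with cons show False ..
    qed
    with False show ?thesis
      by (intro exI[of _ "\<theta> \<^bold>\<and> \<^bold>\<not> \<phi>"]) (auto intro!: taut simp: tautology_def)
  next
    case All: True
    then obtain \<chi> where \<chi>: "\<phi> = All \<chi>" by blast
    obtain n where "closed_fm n (\<theta> \<^bold>\<and> \<phi>)" using ex_closed_fm by blast
    then have n: "closed_fm n \<theta>" "closed_fm (Suc n) \<chi>" using \<chi> by auto
    \<comment> \<open>Variable \<open>n\<close> is free in neither conjunct. If this extension were
      refutable, \<open>gen_fresh\<close> would make the universal formula a consequence of the old
      one, whose conjunction with it is already refutable.\<close>
    let ?\<theta> = "\<theta> \<^bold>\<and> \<^bold>\<not> subst_fm \<chi> 0 (Var n) \<^bold>\<and> \<^bold>\<not> \<phi>"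
    have "\<not> A \<turnstile> \<^bold>\<not> ?\<theta>"
    proof
      assume "A \<turnstile> \<^bold>\<not> ?\<theta>"
      moreover have "A \<turnstile> All \<chi> \<^bold>\<longrightarrow> subst_fm \<chi> 0 (Var n)" by (rule inst)
      ultimately have "A \<turnstile> \<theta> \<^bold>\<longrightarrow> subst_fm \<chi> 0 (Var n)"
        by (rule taut_mp2) (auto simp: tautology_def \<chi>)
      then have "A \<turnstile> \<theta> \<^bold>\<longrightarrow> \<phi>" using gen_fresh n \<chi> by blast
      with True have "A \<turnstile> \<^bold>\<not> \<theta>" by (rule taut_mp2) (auto simp: tautology_def)
      with cons show False ..
    qed
    moreover have "A \<turnstile> ?\<theta> \<^bold>\<longrightarrow> \<^bold>\<not> subst_fm \<chi> 0 (Var n)"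
      by (auto intro!: taut simp: tautology_def)
    ultimately show ?thesis using \<chi>
      by (intro exI[of _ ?\<theta>]) (auto intro!: taut simp: tautology_def)
  qed
qed

text \<open>A complete theory of open formulas: free variables act as constants, so open terms may
  be witnesses. For that reason closure is demanded under modus ponens but not under
  \<open>gen\<close>.\<close>

locale henkin =
  fixes A H :: "fm set"
  assumes derivable_H: "A \<turnstile> \<phi> \<Longrightarrow> \<phi> \<in> H"
    and mp_H: "\<phi> \<^bold>\<longrightarrow> \<psi> \<in> H \<Longrightarrow> \<phi> \<in> H \<Longrightarrow> \<psi> \<in> H"
    and Neg_H: "\<^bold>\<not> \<phi> \<in> H \<longleftrightarrow> \<phi> \<notin> H"
    and witness_H: "All \<phi> \<notin> H \<Longrightarrow> \<exists>t. subst_fm \<phi> 0 t \<notin> H"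

text \<open>A chain of single formulas is built, each implying its predecessor and none refutable;
  step n decides the n-th formula. Membership in the limit means being provably implied by some
  member of the chain, so \<open>gen\<close> and \<open>nec\<close> are never applied under an
  assumption and no deduction theorem is needed.\<close>

lemma henkin_extension:
  assumes "\<not> A \<turnstile> \<phi>"
  shows "\<exists>H. henkin A H \<and> \<phi> \<notin> H"
proof -
  define P where "P n \<theta> \<longleftrightarrow> \<not> A \<turnstile> \<^bold>\<not> \<theta> \<and> (n = 0 \<longrightarrow> \<theta> = \<^bold>\<not> \<phi>)" for n :: nat and \<theta>
  define R where "R n \<theta> \<theta>' \<longleftrightarrow> A \<turnstile> \<theta>' \<^bold>\<longrightarrow> \<theta> \<and>
    (A \<turnstile> \<theta>' \<^bold>\<longrightarrow> from_nat n \<or> A \<turnstile> \<theta>' \<^bold>\<longrightarrow> \<^bold>\<not> from_nat n) \<and>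
    (\<forall>\<chi>. from_nat n = All \<chi> \<longrightarrow> A \<turnstile> \<theta>' \<^bold>\<longrightarrow> from_nat n \<or> (\<exists>t. A \<turnstile> \<theta>' \<^bold>\<longrightarrow> \<^bold>\<not> subst_fm \<chi> 0 t))"
    for n \<theta> \<theta>'
  have "\<not> A \<turnstile> \<^bold>\<not> \<^bold>\<not> \<phi>"
  proof
    assume "A \<turnstile> \<^bold>\<not> \<^bold>\<not> \<phi>"
    then have "A \<turnstile> \<phi>" by (rule taut_mp) (auto simp: tautology_def)
    with assms show False ..
  qed
  then have "\<exists>\<theta>. P 0 \<theta>" by (auto simp: P_def)
  moreover have "\<exists>\<theta>'. P (Suc n) \<theta>' \<and> R n \<theta> \<theta>'" if "P n \<theta>" for n \<theta>
    using henkin_step[of A \<theta> "from_nat n"] that unfolding P_def R_def by blast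
  ultimately have "\<exists>f. \<forall>n. P n (f n) \<and> R n (f n) (f (Suc n))"
    by (rule dependent_nat_choice)
  then obtain f where f: "\<And>n. P n (f n)" "\<And>n. R n (f n) (f (Suc n))" by blast
  define H where "H = {\<psi>. \<exists>n. A \<turnstile> f n \<^bold>\<longrightarrow> \<psi>}"
  have decr: "A \<turnstile> f (n + k) \<^bold>\<longrightarrow> f n" for n k
  proof (induction k)
    case 0 show ?case by (auto intro!: taut simp: tautology_def)
  next
    case (Suc k)
    have "A \<turnstile> f (Suc (n + k)) \<^bold>\<longrightarrow> f (n + k)" using f(2) by (simp add: R_def)
    then show ?case using Suc imp_trans by auto
  qed
  have both: "\<exists>n. A \<turnstile> f n \<^bold>\<longrightarrow> \<psi> \<and> A \<turnstile> f n \<^bold>\<longrightarrow> \<chi>" if "\<psi> \<in> H" "\<chi> \<in> H" for \<psi> \<chi>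
  proof -
    from that obtain n m where "A \<turnstile> f n \<^bold>\<longrightarrow> \<psi>" "A \<turnstile> f m \<^bold>\<longrightarrow> \<chi>" by (auto simp: H_def)
    then have "A \<turnstile> f (n + m) \<^bold>\<longrightarrow> \<psi>" "A \<turnstile> f (n + m) \<^bold>\<longrightarrow> \<chi>"
      using decr[of n m] decr[of m n] by (metis imp_trans add.commute)+
    then show ?thesis by blast
  qed
  have cons: "\<not> (\<psi> \<in> H \<and> \<^bold>\<not> \<psi> \<in> H)" for \<psi>
  proof
    assume "\<psi> \<in> H \<and> \<^bold>\<not> \<psi> \<in> H"
    then obtain n where "A \<turnstile> f n \<^bold>\<longrightarrow> \<psi>" "A \<turnstile> f n \<^bold>\<longrightarrow> \<^bold>\<not> \<psi>" using both by blast
    then have "A \<turnstile> \<^bold>\<not> f n" by (rule taut_mp2) (auto simp: tautology_def)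
    then show False using f(1) by (auto simp: P_def)
  qed
  have "henkin A H"
  proof
    fix \<psi> assume "A \<turnstile> \<psi>"
    then have "A \<turnstile> f 0 \<^bold>\<longrightarrow> \<psi>" by (rule taut_mp) (auto simp: tautology_def)
    then show "\<psi> \<in> H" by (auto simp: H_def)
  next
    fix \<psi> \<chi> assume "\<psi> \<^bold>\<longrightarrow> \<chi> \<in> H" "\<psi> \<in> H"
    then obtain n where "A \<turnstile> f n \<^bold>\<longrightarrow> \<psi> \<^bold>\<longrightarrow> \<chi>" "A \<turnstile> f n \<^bold>\<longrightarrow> \<psi>" using both by blast
    then have "A \<turnstile> f n \<^bold>\<longrightarrow> \<chi>" by (rule taut_mp2) (auto simp: tautology_def)
    then show "\<chi> \<in> H" by (auto simp: H_def)
  next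
    fix \<psi>
    have "\<psi> \<in> H \<or> \<^bold>\<not> \<psi> \<in> H"
      using f(2)[of "to_nat \<psi>"] by (auto simp: H_def R_def)
    then show "\<^bold>\<not> \<psi> \<in> H \<longleftrightarrow> \<psi> \<notin> H" using cons by blast
  next
    fix \<psi> assume "All \<psi> \<notin> H"
    then have "\<exists>t. \<^bold>\<not> subst_fm \<psi> 0 t \<in> H"
      using f(2)[of "to_nat (All \<psi>)"] by (auto simp: H_def R_def)
    then show "\<exists>t. subst_fm \<psi> 0 t \<notin> H" using cons by blast
  qed
  moreover have "\<^bold>\<not> \<phi> \<in> H"
  proof -
    have "A \<turnstile> f 0 \<^bold>\<longrightarrow> \<^bold>\<not> \<phi>" using f(1)[of 0] by (auto intro!: taut simp: tautology_def P_def)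
    then show ?thesis by (auto simp: H_def)
  qed
  ultimately show ?thesis using cons by blast
qed

section \<open>Logical closure of Henkin sets\<close>

context henkin
begin

lemma taut_H: "\<phi> \<in> H \<Longrightarrow> tautology (\<phi> \<^bold>\<longrightarrow> \<psi>) \<Longrightarrow> \<psi> \<in> H"
  by (rule mp_H[OF derivable_H[OF taut]])

lemma Conj_H: "\<phi> \<^bold>\<and> \<psi> \<in> H \<longleftrightarrow> \<phi> \<in> H \<and> \<psi> \<in> H"
proof
  assume "\<phi> \<^bold>\<and> \<psi> \<in> H"
  then show "\<phi> \<in> H \<and> \<psi> \<in> H"
    using taut_H[of "\<phi> \<^bold>\<and> \<psi>" \<phi>] taut_H[of "\<phi> \<^bold>\<and> \<psi>" \<psi>] by (simp add: tautology_def)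
next
  assume a: "\<phi> \<in> H \<and> \<psi> \<in> H"
  have "\<phi> \<^bold>\<longrightarrow> \<psi> \<^bold>\<longrightarrow> (\<phi> \<^bold>\<and> \<psi>) \<in> H"
    by (intro derivable_H taut) (simp add: tautology_def)
  with a show "\<phi> \<^bold>\<and> \<psi> \<in> H" by (metis mp_H)
qed

lemma Disj_H: "\<phi> \<^bold>\<or> \<psi> \<in> H \<longleftrightarrow> \<phi> \<in> H \<or> \<psi> \<in> H"
proof -
  have "\<phi> \<^bold>\<or> \<psi> \<in> H \<longleftrightarrow> \<^bold>\<not> (\<^bold>\<not> \<phi> \<^bold>\<and> \<^bold>\<not> \<psi>) \<in> H"
    using taut_H[of "\<phi> \<^bold>\<or> \<psi>" "\<^bold>\<not> (\<^bold>\<not> \<phi> \<^bold>\<and> \<^bold>\<not> \<psi>)"] taut_H[of "\<^bold>\<not> (\<^bold>\<not> \<phi> \<^bold>\<and> \<^bold>\<not> \<psi>)" "\<phi> \<^bold>\<or> \<psi>"]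
    by (auto simp: tautology_def)
  then show ?thesis by (simp add: Neg_H Conj_H)
qed

lemma All_H: "All \<phi> \<in> H \<longleftrightarrow> (\<forall>t. subst_fm \<phi> 0 t \<in> H)"
  using mp_H[OF derivable_H[OF inst]] witness_H by metis

lemma refl_H: "t \<approx> t \<in> H"
  by (rule derivable_H[OF eq_refl])

lemma eq_subst_H: "s \<approx> t \<in> H \<Longrightarrow> subst_fm \<phi> 0 s \<in> H \<Longrightarrow> subst_fm \<phi> 0 t \<in> H"
  by (rule mp_H[OF mp_H[OF derivable_H[OF eq_subst]]])

lemma subst_lift_tm [simp]: "subst_tm (lift_tm 0 t) 0 u = t"
  by (induction t) auto

lemma sym_H: "s \<approx> t \<in> H \<Longrightarrow> t \<approx> s \<in> H"
  using eq_subst_H[of s t "Var 0 \<approx> lift_tm 0 s"] refl_H by auto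

lemma trans_H: "s \<approx> t \<in> H \<Longrightarrow> t \<approx> u \<in> H \<Longrightarrow> s \<approx> u \<in> H"
  using eq_subst_H[of t u "lift_tm 0 s \<approx> Var 0"] by auto

lemma psubst_H: "A \<turnstile> \<phi> \<Longrightarrow> psubst \<sigma> \<phi> \<in> H"
  by (auto intro: derivable_H derivable_psubst)

end

text \<open>Each case is an instance of \<open>eq_subst\<close> for an atomic formula in which
  \<open>Var 0\<close> marks the place to be rewritten; the other terms are lifted so that the
  substitution leaves them alone.\<close>

lemma (in henkin) cong_H:
  assumes "s \<approx> s' \<in> H"
  shows "Minus s \<approx> Minus s' \<in> H" "Inv s \<approx> Inv s' \<in> H" "Nat s \<in> H \<Longrightarrow> Nat s' \<in> H"
    "s \<oplus> t \<approx> s' \<oplus> t \<in> H" "t \<oplus> s \<approx> t \<oplus> s' \<in> H"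
    "s \<otimes> t \<approx> s' \<otimes> t \<in> H" "t \<otimes> s \<approx> t \<otimes> s' \<in> H"
    "s \<prec> t \<in> H \<Longrightarrow> s' \<prec> t \<in> H" "t \<prec> s \<in> H \<Longrightarrow> t \<prec> s' \<in> H"
    "Prob s t \<in> H \<Longrightarrow> Prob s' t \<in> H" "Prob t s \<in> H \<Longrightarrow> Prob t s' \<in> H"
  using eq_subst_H[OF assms, of "Minus (lift_tm 0 s) \<approx> Minus (Var 0)"] refl_H[of "Minus s"] apply simp
  using eq_subst_H[OF assms, of "Inv (lift_tm 0 s) \<approx> Inv (Var 0)"] refl_H[of "Inv s"] apply simp
  using eq_subst_H[OF assms, of "Nat (Var 0)"] apply simp
  using eq_subst_H[OF assms, of "lift_tm 0 (s \<oplus> t) \<approx> Var 0 \<oplus> lift_tm 0 t"] refl_H[of "s \<oplus> t"] apply simp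
  using eq_subst_H[OF assms, of "lift_tm 0 (t \<oplus> s) \<approx> lift_tm 0 t \<oplus> Var 0"] refl_H[of "t \<oplus> s"] apply simp
  using eq_subst_H[OF assms, of "lift_tm 0 (s \<otimes> t) \<approx> Var 0 \<otimes> lift_tm 0 t"] refl_H[of "s \<otimes> t"] apply simp
  using eq_subst_H[OF assms, of "lift_tm 0 (t \<otimes> s) \<approx> lift_tm 0 t \<otimes> Var 0"] refl_H[of "t \<otimes> s"] apply simp
  using eq_subst_H[OF assms, of "Var 0 \<prec> lift_tm 0 t"] apply simp
  using eq_subst_H[OF assms, of "lift_tm 0 t \<prec> Var 0"] apply simp
  using eq_subst_H[OF assms, of "Prob (Var 0) (lift_tm 0 t)"] apply simp
  using eq_subst_H[OF assms, of "Prob (lift_tm 0 t) (Var 0)"] apply simp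
  done

text \<open>
  The domain is a full type rather than a set of classes of terms, so that the locale of ordered rings
  can be interpreted in models.
\<close>

lemma (in henkin) ex_model:
  fixes c :: "tm \<Rightarrow> 'a"
  assumes surj: "surj c" and c: "\<And>s t. c s = c t \<longleftrightarrow> s \<approx> t \<in> H"
  shows "\<exists>M :: 'a struct. model A M \<and> (\<forall>\<phi>. sat M (\<lambda>i. c (Var i)) \<phi> \<longleftrightarrow> \<phi> \<in> H)"
proof -
  \<comment> \<open>A choice of representative terms. The operations of the structure are defined on
    representatives, and \<open>cong_H\<close> makes the choice immaterial.\<close>
  define r where "r = inv c"
  have cr [simp]: "c (r x) = x" for x by (simp add: r_def surj surj_f_inv_f)
  then have rc: "r (c t) \<approx> t \<in> H" "t \<approx> r (c t) \<in> H" for t by (simp_all flip: c)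
  define M where "M = \<lparr>zero_of = c Zero, one_of = c One,
    plus_of = (\<lambda>x y. c (r x \<oplus> r y)), times_of = (\<lambda>x y. c (r x \<otimes> r y)),
    minus_of = (\<lambda>x. c (Minus (r x))), inv_of = (\<lambda>x. c (Inv (r x))),
    less_of = (\<lambda>x y. r x \<prec> r y \<in> H), nat_of = (\<lambda>x. Nat (r x) \<in> H),
    prob_of = (\<lambda>x y. Prob (r x) (r y) \<in> H)\<rparr>"
  let ?e = "\<lambda>i. c (Var i)"
  have eval: "eval_tm M ?e t = c t" for t
  proof (induction t)
    case (Add s t)
    have "r (c s) \<oplus> r (c t) \<approx> s \<oplus> t \<in> H"
      by (rule trans_H[OF cong_H(4) cong_H(5)]) (rule rc)+
    then show ?case using Add by (simp add: M_def c)
  next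
    case (Mul s t)
    have "r (c s) \<otimes> r (c t) \<approx> s \<otimes> t \<in> H"
      by (rule trans_H[OF cong_H(6) cong_H(7)]) (rule rc)+
    then show ?case using Mul by (simp add: M_def c)
  qed (simp_all add: M_def c cong_H rc)
  have sat: "sat M ?e \<phi> \<longleftrightarrow> \<phi> \<in> H" for \<phi>
  \<comment> \<open>The quantifier case passes to instances of the matrix, which are not subformulas
    but have the same size as the matrix.\<close>
  proof (induction "size \<phi>" arbitrary: \<phi> rule: less_induct)
    case less
    show ?case
    proof (cases \<phi>)
      case (Less s t)
      then show ?thesis by (simp add: eval) (simp add: M_def, meson cong_H rc)
    next
      case (Nat t)
      then show ?thesis by (simp add: eval) (simp add: M_def, meson cong_H rc)
    next
      case (Prob s t)
      then show ?thesis by (simp add: eval) (simp add: M_def, meson cong_H rc)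
    next
      case (All \<chi>)
      have "sat M ?e \<phi> \<longleftrightarrow> (\<forall>t. sat M (c t ## ?e) \<chi>)"
        using All surj by (auto simp: surj_def) metis
      also have "\<dots> \<longleftrightarrow> (\<forall>t. sat M ?e (subst_fm \<chi> 0 t))"
        by (simp add: sat_subst eval)
      also have "\<dots> \<longleftrightarrow> (\<forall>t. subst_fm \<chi> 0 t \<in> H)"
        using less All by simp
      finally show ?thesis using All by (simp add: All_H)
    qed (use less in \<open>auto simp: eval c Neg_H Conj_H Disj_H\<close>)
  qed
  have "model A M"
    unfolding model_def
  proof (intro allI impI)
    fix \<phi> e assume "A \<turnstile> \<phi>"
    \<comment> \<open>Substituting representatives for variables turns the canonical assignment into
      \<open>e\<close>, so closure of the theorems under substitution covers all
      assignments.\<close>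
    then have "sat M ?e (psubst (\<lambda>i. r (e i)) \<phi>)" by (simp add: sat psubst_H)
    then show "sat M e \<phi>" by (simp add: sat_psubst eval)
  qed
  with sat show ?thesis by blast
qed

context henkin
begin

text \<open>
  The order axioms force infinitely many classes, so that \<^typ>\<open>nat\<close> can serve as the domain.
\<close>

lemma num_distinct:
  assumes A: "ordered_field_axioms \<subseteq> A" and "i < j"
  shows "num i \<approx> num j \<notin> H"
proof -
  have ax: "psubst \<sigma> \<phi> \<in> H" if "\<phi> \<in> ordered_field_axioms" for \<phi> \<sigma>
    using psubst_H[OF ax] that A by blast
  define \<sigma> where "\<sigma> s t u i = (if i = 0 then s else if i = 1 then t else u)" for s t u :: tm and i :: nat
  have \<sigma> [simp]: "\<sigma> s t u 0 = s" "\<sigma> s t u (Suc 0) = t" "\<sigma> s t u 2 = u" for s t u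
    by (simp_all add: \<sigma>_def)
  have irrefl: "t \<prec> t \<notin> H" for t
    using ax[of "\<^bold>\<not> Var 0 \<prec> Var 0" "\<sigma> t t t"]
    by (simp add: ordered_field_axioms_def Neg_H)
  have less_trans: "s \<prec> t \<in> H \<Longrightarrow> t \<prec> u \<in> H \<Longrightarrow> s \<prec> u \<in> H" for s t u
    using ax[of "Var 0 \<prec> Var 1 \<^bold>\<and> Var 1 \<prec> Var 2 \<^bold>\<longrightarrow> Var 0 \<prec> Var 2" "\<sigma> s t u"]
    by (simp add: ordered_field_axioms_def Neg_H Disj_H Conj_H)
  \<comment> \<open>The sign of \<open>One\<close> is left open: the numerals form a strictly
    increasing or a strictly decreasing sequence, and are distinct in either case.\<close>
  have "Zero \<prec> One \<in> H \<or> One \<prec> Zero \<in> H"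
    using ax[of "Var 0 \<prec> Var 1 \<^bold>\<or> Var 0 \<approx> Var 1 \<^bold>\<or> Var 1 \<prec> Var 0" "\<sigma> Zero One One"]
      ax[of "\<^bold>\<not> Zero \<approx> One" "\<sigma> Zero One One"]
    by (simp add: ordered_field_axioms_def Neg_H Disj_H Conj_H)
  have less_plus: "s \<prec> t \<in> H \<Longrightarrow> s \<oplus> u \<prec> t \<oplus> u \<in> H" for s t u
    using ax[of "Var 0 \<prec> Var 1 \<^bold>\<longrightarrow> Var 0 \<oplus> Var 2 \<prec> Var 1 \<oplus> Var 2" "\<sigma> s t u"]
    by (simp add: ordered_field_axioms_def Neg_H Disj_H Conj_H)
  have comm: "s \<oplus> t \<approx> t \<oplus> s \<in> H" for s t
    using ax[of "Var 0 \<oplus> Var 1 \<approx> Var 1 \<oplus> Var 0" "\<sigma> s t t"]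
    by (simp add: ordered_field_axioms_def)
  have zero: "Zero \<oplus> s \<approx> s \<in> H" for s
    using trans_H[OF comm, of s Zero s] ax[of "Var 0 \<oplus> Zero \<approx> Var 0" "\<sigma> s s s"]
    by (simp add: ordered_field_axioms_def)
  have step: "(Zero \<prec> One \<in> H \<longrightarrow> num i \<prec> num (Suc i) \<in> H) \<and>
    (One \<prec> Zero \<in> H \<longrightarrow> num (Suc i) \<prec> num i \<in> H)" for i
    using less_plus[of Zero One "num i"] less_plus[of One Zero "num i"]
      cong_H(8)[OF zero] cong_H(9)[OF zero] cong_H(8)[OF comm] cong_H(9)[OF comm]
    by (metis num.simps(2))
  have less: "(Zero \<prec> One \<in> H \<longrightarrow> num i \<prec> num (i + Suc k) \<in> H) \<and>
    (One \<prec> Zero \<in> H \<longrightarrow> num (i + Suc k) \<prec> num i \<in> H)" for k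
  proof (induction k)
    case 0 show ?case using step[of i] by simp
  next
    case (Suc k)
    show ?case using Suc.IH step[of "i + Suc k"] less_trans by (metis add_Suc_right)
  qed
  obtain k where k: "j = i + Suc k" using \<open>i < j\<close> less_imp_Suc_add by auto
  show ?thesis
  proof
    assume "num i \<approx> num j \<in> H"
    then show False
      using less[of k] k irrefl \<open>Zero \<prec> One \<in> H \<or> One \<prec> Zero \<in> H\<close> cong_H(8) cong_H(9) by metis
  qed
qed

end

text \<open>A non-theorem is missing from some Henkin set. Its term classes are countable, as terms
  are, and infinitely many by \<open>num_distinct\<close>; numbering them yields a countermodel on
  \<open>nat\<close>. The conclusion is derivability with Necessitation, so facts about models can
  be fed back into \<open>nec\<close>.\<close>

theorem completeness:
  assumes A: "ordered_field_axioms \<subseteq> A" and valid: "\<And>(M :: nat struct) e. model A M \<Longrightarrow> sat M e \<phi>"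
  shows "A \<turnstile> \<phi>"
proof (rule ccontr)
  assume "\<not> A \<turnstile> \<phi>"
  then obtain H where "henkin A H" and \<phi>: "\<phi> \<notin> H" using henkin_extension by blast
  then interpret henkin A H by simp
  define cl where "cl t = {s. s \<approx> t \<in> H}" for t
  have cl: "cl s = cl t \<longleftrightarrow> s \<approx> t \<in> H" for s t
    unfolding cl_def set_eq_iff mem_Collect_eq using refl_H sym_H trans_H by metis
  have "inj (\<lambda>i. cl (num i))"
    using num_distinct[OF A] sym_H unfolding inj_def cl by (metis linorder_neqE_nat)
  then have "infinite (range cl)"
    using finite_subset[of "range (\<lambda>i. cl (num i))" "range cl"] range_inj_infinite by blast
  then have bij: "bij_betw (to_nat_on (range cl)) (range cl) UNIV"
    by (intro to_nat_on_infinite) simp_all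
  define c where "c t = to_nat_on (range cl) (cl t)" for t
  have "surj c"
    using bij by (auto simp: c_def bij_betw_def image_image)
  moreover have "c s = c t \<longleftrightarrow> s \<approx> t \<in> H" for s t
    using bij by (auto simp: c_def bij_betw_def inj_on_eq_iff simp flip: cl)
  ultimately obtain M :: "nat struct" where "model A M" "\<not> sat M (\<lambda>i. c (Var i)) \<phi>"
    using ex_model[of c] \<phi> by blast
  with valid show False by blast
qed


section \<open>Arithmetic in models\<close>

lemma eval_tm_cong:
  "closed_tm n t \<Longrightarrow> (\<And>i. i < n \<Longrightarrow> e i = e' i) \<Longrightarrow> eval_tm M e t = eval_tm M e' t"
  by (induction t) auto

lemma sat_cong:
  "closed_fm n \<phi> \<Longrightarrow> (\<And>i. i < n \<Longrightarrow> e i = e' i) \<Longrightarrow> sat M e \<phi> \<longleftrightarrow> sat M e' \<phi>"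
proof (induction \<phi> arbitrary: n e e')
  case (Eq s t)
  then show ?case using eval_tm_cong[of n s e e'] eval_tm_cong[of n t e e'] by simp
next
  case (Less s t)
  then show ?case using eval_tm_cong[of n s e e'] eval_tm_cong[of n t e e'] by simp
next
  case (Nat t)
  then show ?case using eval_tm_cong[of n t e e'] by simp
next
  case (Prob s t)
  then show ?case using eval_tm_cong[of n s e e'] eval_tm_cong[of n t e e'] by simp
next
  case (Neg \<phi>)
  from Neg.prems show ?case using Neg.IH[of n e e'] by simp
next
  case (Conj \<phi> \<psi>)
  from Conj.prems show ?case using Conj.IH[of n e e'] by simp
next
  case (Disj \<phi> \<psi>)
  from Disj.prems show ?case using Disj.IH[of n e e'] by simp
next
  case (All \<phi>)
  have "sat M (x ## e) \<phi> \<longleftrightarrow> sat M (x ## e') \<phi>" for x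
  proof (rule All.IH)
    show "closed_fm (Suc n) \<phi>" using All.prems(1) by simp
    show "(x ## e) i = (x ## e') i" if "i < Suc n" for i
      using that All.prems(2) by (cases i) auto
  qed
  then show ?case by simp
qed

lemma lifts_3: "lifts 3 t = lift_tm 0 (lift_tm 0 (lift_tm 0 t))"
  by (simp add: numeral_3_eq_3)

lemma lift_num [simp]: "lift_tm k (num n) = num n"
  by (induction n) auto

lemma closed_num [simp]: "closed_tm k (num n)"
  by (induction n) auto

text \<open>Cross-multiplying by \<open>Suc y\<close> and \<open>Suc x\<close> shows that a common
  divisor divides y - x, hence b!, hence the product in the first modulus, and therefore 1.\<close>

lemma coprime_moduli:
  assumes "x < y" "y \<le> b"
  shows "coprime (Suc (Suc x * fact b)) (Suc (Suc y * fact b))"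
proof (rule coprimeI)
  fix g assume g: "g dvd Suc (Suc x * fact b)" "g dvd Suc (Suc y * fact b)"
  have "Suc y * Suc (Suc x * fact b) = Suc x * Suc (Suc y * fact b) + (y - x)"
    using assms by (simp add: algebra_simps)
  then have "g dvd y - x" using g by (metis dvd_add_right_iff dvd_mult)
  moreover have "y - x dvd fact b" using assms by (intro dvd_fact) auto
  ultimately have "g dvd Suc x * fact b" by (meson dvd_mult dvd_trans)
  then show "is_unit g" using g(1) by (metis Suc_eq_plus1 dvd_add_right_iff)
qed

text \<open>With d = b!, let c be the product of the moduli of the members. The modulus of a
  non-member below b is coprime to c and exceeds 1, so it does not divide c.\<close>

lemma ex_set_code:
  assumes "finite S"
  shows "\<exists>b c d. \<forall>k. k < b \<and> Suc (Suc k * d) dvd c \<longleftrightarrow> k \<in> S"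
proof -
  obtain b where b: "\<And>k. k \<in> S \<Longrightarrow> k < b"
    using finite_nat_bounded[OF assms] by auto
  define c where "c = (\<Prod>x\<in>S. Suc (Suc x * fact b))"
  have "k < b \<and> Suc (Suc k * fact b) dvd c \<longleftrightarrow> k \<in> S" for k
  proof
    assume k: "k < b \<and> Suc (Suc k * fact b) dvd c"
    show "k \<in> S"
    proof (rule ccontr)
      assume "k \<notin> S"
      then have "coprime (Suc (Suc k * fact b)) (Suc (Suc x * fact b))" if "x \<in> S" for x
        using coprime_moduli[of x k b] coprime_moduli[of k x b] b[OF that] k that
        by (metis coprime_commute less_imp_le linorder_neqE_nat)
      then have "coprime (Suc (Suc k * fact b)) c"
        unfolding c_def by (rule prod_coprime_right)
      with k show False by (simp add: coprime_absorb_left)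
    qed
  next
    assume "k \<in> S"
    then show "k < b \<and> Suc (Suc k * fact b) dvd c"
      using assms b unfolding c_def by (auto intro: dvd_prod_eqI)
  qed
  then show ?thesis by blast
qed

section \<open>Ordered ring and natural numbers of a model\<close>

locale rkf_model =
  fixes M :: "'a struct"
  assumes model: "model (RKf \<union> RV) M"
begin

abbreviation Z where "Z \<equiv> zero_of M"
abbreviation U where "U \<equiv> one_of M"
abbreviation N where "N \<equiv> nat_of M"
abbreviation P where "P \<equiv> prob_of M"
abbreviation plus (infixl "[+]" 65) where "x [+] y \<equiv> plus_of M x y"
abbreviation times (infixl "[*]" 70) where "x [*] y \<equiv> times_of M x y"
abbreviation less (infix "[<]" 50) where "x [<] y \<equiv> less_of M x y"
abbreviation leq (infix "[\<le>]" 50) where "x [\<le>] y \<equiv> less_of M x y \<or> x = y"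

lemma sat_derivable: "RKf \<union> RV \<turnstile> \<phi> \<Longrightarrow> sat M e \<phi>"
  using model by (simp add: model_def)

lemma sat_ax: "\<phi> \<in> RKf \<union> RV \<Longrightarrow> sat M e \<phi>"
  by (rule sat_derivable[OF ax])

lemma sat_peano: "\<phi> \<in> peano_axioms \<Longrightarrow> sat M e \<phi>"
  by (rule sat_ax) (simp add: RKf_def Q_pr_def rational_axioms_def)

lemma sat_field_axioms: "\<forall>\<phi>\<in>ordered_field_axioms. sat M (x ## y ## z ## (\<lambda>_. Z)) \<phi>"
  by (auto intro: sat_ax simp: RKf_def Q_pr_def rational_axioms_def)

lemma field_axioms:
  "(x [+] y) [+] z = x [+] (y [+] z)"
  "x [+] y = y [+] x"
  "x [+] Z = x"
  "x [+] minus_of M x = Z"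
  "(x [*] y) [*] z = x [*] (y [*] z)"
  "x [*] y = y [*] x"
  "x [*] U = x"
  "x [*] (y [+] z) = x [*] y [+] x [*] z"
  "Z \<noteq> U"
  "x \<noteq> Z \<Longrightarrow> x [*] inv_of M x = U"
  "\<not> x [<] x"
  "x [<] y \<Longrightarrow> y [<] z \<Longrightarrow> x [<] z"
  "x [<] y \<or> x = y \<or> y [<] x"
  "x [<] y \<Longrightarrow> x [+] z [<] y [+] z"
  "Z [<] x \<Longrightarrow> Z [<] y \<Longrightarrow> Z [<] x [*] y"
  using sat_field_axioms[of x y z, unfolded ordered_field_axioms_def, simplified] by satx+

definition minus (infixl "[-]" 65) where "x [-] y = x [+] minus_of M y"

lemma comm_ring: "class.comm_ring_1 times U plus Z minus (minus_of M)"
proof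
  fix a b c
  show "a [*] b [*] c = a [*] (b [*] c)" by (rule field_axioms)
  show "a [*] b = b [*] a" by (rule field_axioms)
  show "U [*] a = a" using field_axioms(6,7) by metis
  show "a [+] b [+] c = a [+] (b [+] c)" by (rule field_axioms)
  show "a [+] b = b [+] a" by (rule field_axioms)
  show "Z [+] a = a" using field_axioms(2,3) by metis
  show "minus_of M a [+] a = Z" using field_axioms(2,4) by metis
  show "(a [+] b) [*] c = a [*] c [+] b [*] c" using field_axioms(6,8) by metis
  show "Z \<noteq> U" by (rule field_axioms)
qed (simp add: minus_def)

text \<open>Makes the general lemmas on ordered rings available for all elements of the model. The
  two conditionals are the sign and the absolute value that the class asks for.\<close>

sublocale F: linordered_idom plus Z minus "minus_of M" leq less
  "\<lambda>x. if x = Z then Z else if Z [<] x then U else minus_of M U"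
  "\<lambda>x. if x [<] Z then minus_of M x else x" times U
proof -
  interpret R: comm_ring_1 times U plus Z minus "minus_of M"
    by (rule comm_ring)
  \<comment> \<open>The axiom speaks of products of positive elements only; it is applied to c and b
    - a.\<close>
  have mono: "c [*] a [<] c [*] b" if "a [<] b" "Z [<] c" for a b c
  proof -
    have "Z [<] b [+] minus_of M a"
      using field_axioms(14)[OF that(1), of "minus_of M a"] unfolding field_axioms(4) .
    then have "Z [<] c [*] (b [-] a)" using that(2) field_axioms(15) unfolding minus_def by blast
    then have "Z [+] c [*] a [<] c [*] (b [-] a) [+] c [*] a" by (rule field_axioms(14))
    then show ?thesis by (simp add: R.right_diff_distrib)
  qed
  show "class.linordered_idom plus Z minus (minus_of M) leq less
    (\<lambda>x. if x = Z then Z else if Z [<] x then U else minus_of M U)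
    (\<lambda>x. if x [<] Z then minus_of M x else x) times U"
  proof
    fix x y z a b c
    show "(x [<] y) = (x [\<le>] y \<and> \<not> y [\<le>] x)" using field_axioms(11,12) by metis
    show "x [\<le>] y \<Longrightarrow> y [\<le>] z \<Longrightarrow> x [\<le>] z" using field_axioms(12) by metis
    show "x [\<le>] y \<Longrightarrow> y [\<le>] x \<Longrightarrow> x = y" using field_axioms(11,12) by metis
    show "a [\<le>] b \<Longrightarrow> c [+] a [\<le>] c [+] b" using field_axioms(2,14) by metis
    show "x [\<le>] y \<or> y [\<le>] x" using field_axioms(13) by metis
    show "a [<] b \<Longrightarrow> Z [<] c \<Longrightarrow> c [*] a [<] c [*] b" by (rule mono)
    show "x [\<le>] x" by simp
    show "(if x [<] Z then minus_of M x else x) = (if x [<] Z then minus_of M x else x)" by (rule refl)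
    show "(if x = Z then Z else if Z [<] x then U else minus_of M U) = (if x = Z then Z else if Z [<] x then U else minus_of M U)" by (rule refl)
  qed
qed

lemma N_closed [simp]: "N Z" "N U" "N x \<Longrightarrow> N y \<Longrightarrow> N (x [+] y)" "N x \<Longrightarrow> N y \<Longrightarrow> N (x [*] y)"
proof -
  show N: "N Z"
    using sat_peano[of "Nat Zero"] by (simp add: peano_axioms_def)
  have "N x \<Longrightarrow> N (x [+] U)" for x
    using sat_peano[of "Nat x0 \<^bold>\<longrightarrow> Nat (x0 \<oplus> One)" "\<lambda>_. x"] by (simp add: peano_axioms_def)
  from this[of Z] N show "N U" by simp
  show "N x \<Longrightarrow> N y \<Longrightarrow> N (x [+] y)"
    using sat_peano[of "Nat x0 \<^bold>\<and> Nat x1 \<^bold>\<longrightarrow> Nat (x0 \<oplus> x1)" "x ## (\<lambda>_. y)"]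
    by (simp add: peano_axioms_def)
  show "N x \<Longrightarrow> N y \<Longrightarrow> N (x [*] y)"
    using sat_peano[of "Nat x0 \<^bold>\<and> Nat x1 \<^bold>\<longrightarrow> Nat (x0 \<otimes> x1)" "x ## (\<lambda>_. y)"]
    by (simp add: peano_axioms_def)
qed

text \<open>The model may be nonstandard, so induction on \<open>N\<close> is available only for
  properties given by a formula, with parameters from \<open>e\<close>.\<close>

lemma sat_induction:
  assumes "N x" and "sat M (Z ## e) \<phi>"
    and "\<And>x. N x \<Longrightarrow> sat M (x ## e) \<phi> \<Longrightarrow> sat M ((x [+] U) ## e) \<phi>"
  shows "sat M (x ## e) \<phi>"
proof -
  have "sat M e (induction \<phi>)"
    by (rule sat_ax) (simp add: RKf_def Q_pr_def rational_axioms_def)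
  then show ?thesis
    using assms by (simp add: induction_def sat_subst sat_lift_1[simplified])
qed

lemma N_nonneg: "N x \<Longrightarrow> Z [\<le>] x"
  using sat_induction[of x _ "Zero \<preceq> Var 0"]
  by simp

lemma N_cases:
  assumes "N x"
  obtains "x = Z" | y where "N y" "x = y [+] U"
  using sat_induction[OF assms, of _ "Var 0 \<approx> Zero \<^bold>\<or> ExN (Var 1 \<approx> Var 0 \<oplus> One)"] by auto

lemma N_discrete:
  assumes "N x" "N y" "y [<] x"
  shows "y [+] U [\<le>] x"
proof -
  \<comment> \<open>The smaller number is quantified inside the induction formula because the
    induction step passes to its predecessor.\<close>
  have "sat M (x ## (\<lambda>_. Z)) (AllN (Var 0 \<prec> Var 1 \<^bold>\<longrightarrow> Var 0 \<oplus> One \<preceq> Var 1))"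
  proof (rule sat_induction[OF \<open>N x\<close>])
    show "sat M (Z ## (\<lambda>_. Z)) (AllN (Var 0 \<prec> Var 1 \<^bold>\<longrightarrow> Var 0 \<oplus> One \<preceq> Var 1))"
      using N_nonneg F.leD by auto
  next
    fix x
    assume "N x" and "sat M (x ## (\<lambda>_. Z)) (AllN (Var 0 \<prec> Var 1 \<^bold>\<longrightarrow> Var 0 \<oplus> One \<preceq> Var 1))"
    then have IH: "N y \<Longrightarrow> y [<] x \<Longrightarrow> y [+] U [\<le>] x" for y by auto
    have "y [+] U [\<le>] x [+] U" if "N y" "y [<] x [+] U" for y
      using \<open>N y\<close>
    proof (cases rule: N_cases)
      case 1
      then show ?thesis using N_nonneg[OF \<open>N x\<close>] F.add_right_mono[of Z x U] by simp
    next
      case (2 z)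
      then have "z [<] x" using that by simp
      then show ?thesis using IH[OF \<open>N z\<close>] 2 F.add_right_mono by blast
    qed
    then show "sat M ((x [+] U) ## (\<lambda>_. Z)) (AllN (Var 0 \<prec> Var 1 \<^bold>\<longrightarrow> Var 0 \<oplus> One \<preceq> Var 1))"
      by auto
  qed
  then show ?thesis using assms by auto
qed

text \<open>The standard natural numbers of the model; \<open>N\<close> may hold of further
  elements.\<close>

definition nn :: "nat \<Rightarrow> 'a" where "nn n = F.of_nat n"

lemma nn_simps: "nn 0 = Z" "nn (Suc n) = nn n [+] U"
  "nn (m + n) = nn m [+] nn n" "nn (m * n) = nn m [*] nn n"
  by (simp_all add: nn_def F.add_commute)

lemma nn_inject [simp]: "nn m = nn n \<longleftrightarrow> m = n"
  by (simp add: nn_def)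

lemma nn_less [simp]: "nn m [<] nn n \<longleftrightarrow> m < n"
  by (simp add: nn_def)

lemma eval_num [simp]: "eval_tm M e (num n) = nn n"
  by (induction n) (simp_all add: nn_simps)

lemma N_nn [simp]: "N (nn n)"
  by (induction n) (simp_all add: nn_simps)

text \<open>Nothing nonstandard lies below a standard number, so conditions with standard bounds
  reduce to ordinary arithmetic.\<close>

lemma below_nn:
  assumes "N x" "x [<] nn n"
  shows "\<exists>m<n. x = nn m"
  using assms
proof (induction n arbitrary: x)
  case 0
  then show ?case using N_nonneg[of x] F.leD by (auto simp: nn_simps)
next
  case (Suc n)
  from \<open>N x\<close> show ?case
  proof (cases rule: N_cases)
    case 1
    then show ?thesis by (auto intro!: exI[of _ 0] simp: nn_simps)
  next
    case (2 y)
    then have "y [<] nn n" using Suc.prems by (simp add: nn_simps)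
    with Suc.IH 2 obtain m where "m < n" "y = nn m" by blast
    then show ?thesis using 2 by (auto intro!: exI[of _ "Suc m"] simp: nn_simps)
  qed
qed

section \<open>Pairing in a model\<close>

definition pr :: "'a \<Rightarrow> 'a \<Rightarrow> 'a" where "pr x y = (x [+] y) [*] (x [+] y) [+] x"

lemma eval_pair [simp]: "eval_tm M e (pair_tm s t) = pr (eval_tm M e s) (eval_tm M e t)"
  by (simp add: pair_tm_def pr_def)

lemma eval_op1 [simp]: "eval_tm M e (op1 j s) = pr (nn j) (eval_tm M e s)"
  by (simp add: op1_def)

lemma eval_op2 [simp]: "eval_tm M e (op2 j s t) = pr (nn j) (pr (eval_tm M e s) (eval_tm M e t))"
  by (simp add: op2_def)

lemma nn_pair [simp]: "nn (pair m n) = pr (nn m) (nn n)"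
  by (simp add: pair_def pr_def nn_simps)

lemma N_pr [simp]: "N x \<Longrightarrow> N y \<Longrightarrow> N (pr x y)"
  by (simp add: pr_def)

text \<open>The comparison of squares from \<open>pair_less\<close>, now for possibly nonstandard
  elements: \<open>N_discrete\<close> supplies the gap of one between different sums.\<close>

lemma pr_less:
  assumes "N x" "N y" "N x'" "N y'" "x [+] y [<] x' [+] y'"
  shows "pr x y [<] pr x' y'"
proof -
  let ?s = "x [+] y" and ?s' = "x' [+] y'"
  have s: "Z [\<le>] ?s" "Z [\<le>] x'" using assms by (auto intro!: N_nonneg)
  have "x [\<le>] ?s" using F.add_left_mono[OF N_nonneg[OF \<open>N y\<close>], of x] by simp
  also have "?s [\<le>] U [*] ?s" by simp
  also have "U [*] ?s [<] U [*] ?s [+] (?s [+] U)"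
    using s F.add_nonneg_pos[of ?s U] F.zero_less_one F.less_add_same_cancel1 by simp
  finally have x: "x [<] U [*] ?s [+] (?s [+] U)" .
  have "pr x y [<] ?s [*] ?s [+] (U [*] ?s [+] (?s [+] U))"
    unfolding pr_def using x by (rule F.add_strict_left_mono)
  also have "\<dots> = (?s [+] U) [*] (?s [+] U)"
    by (simp add: F.distrib_left F.distrib_right F.add_ac)
  also have "\<dots> [\<le>] ?s' [*] ?s'"
    using N_discrete[OF _ _ assms(5)] assms s by (intro F.mult_mono F.add_nonneg_nonneg) (auto simp: N_nonneg)
  also have "?s' [*] ?s' [\<le>] pr x' y'"
    unfolding pr_def using F.add_left_mono[OF s(2), of "?s' [*] ?s'"] by simp
  finally show ?thesis .
qed

lemma pr_inject [simp]:
  assumes "N x" "N y" "N x'" "N y'"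
  shows "pr x y = pr x' y' \<longleftrightarrow> x = x' \<and> y = y'"
proof
  assume eq: "pr x y = pr x' y'"
  then have "\<not> x [+] y [<] x' [+] y'" "\<not> x' [+] y' [<] x [+] y"
    using pr_less[of x y x' y'] pr_less[of x' y' x y] assms field_axioms(11) by metis+
  then have "x [+] y = x' [+] y'" using field_axioms(13) by blast
  with eq show "x = x' \<and> y = y'" by (simp add: pr_def)
qed simp

section \<open>Coded finite sets in a model\<close>

definition MEM :: "'a \<Rightarrow> 'a \<Rightarrow> 'a \<Rightarrow> 'a \<Rightarrow> bool"
  where "MEM b c d x \<longleftrightarrow> N x \<and> x [<] b \<and> (\<exists>q. N q \<and> q [\<le>] c \<and> q [*] (U [+] (x [+] U) [*] d) = c)"

lemma sat_mem [simp]: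
  "sat M e (mem j t) \<longleftrightarrow> MEM (e (Suc (Suc j))) (e (Suc j)) (e j) (eval_tm M e t)"
  by (auto simp: mem_def MEM_def)

text \<open>The bounds in \<open>mem\<close> on the element and on the quotient are standard here,
  so by \<open>below_nn\<close> both are standard and the condition is genuine divisibility.\<close>

lemma MEM_nn: "MEM (nn b) (nn c) (nn d) x \<longleftrightarrow> (\<exists>k<b. x = nn k \<and> Suc (Suc k * d) dvd c)"
proof -
  have modulus: "U [+] (nn k [+] U) [*] nn d = nn (Suc (Suc k * d))" for k
    by (simp add: nn_simps F.distrib_right F.add_ac)
  have leq: "nn m [\<le>] nn n \<longleftrightarrow> m \<le> n" for m n by auto
  show ?thesis
  proof
    assume mem: "MEM (nn b) (nn c) (nn d) x"
    then obtain k where k: "k < b" "x = nn k" using below_nn by (auto simp: MEM_def)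
    obtain q where q: "N q" "q [\<le>] nn c" "q [*] nn (Suc (Suc k * d)) = nn c"
      using mem unfolding MEM_def k modulus by blast
    obtain m where "q = nn m" using below_nn[OF q(1)] q(2) by blast
    then have "m * Suc (Suc k * d) = c" using q(3) by (simp flip: nn_simps(4))
    with k show "\<exists>k<b. x = nn k \<and> Suc (Suc k * d) dvd c" by (metis dvd_triv_right)
  next
    assume "\<exists>k<b. x = nn k \<and> Suc (Suc k * d) dvd c"
    then obtain k m where k: "k < b" "x = nn k" "c = m * Suc (Suc k * d)"
      by (metis dvd_def mult.commute)
    have "N (nn m) \<and> nn m [\<le>] nn c \<and> nn m [*] nn (Suc (Suc k * d)) = nn c"
      unfolding leq nn_simps(4)[symmetric] by (simp add: k)
    moreover have "N (nn k)" "nn k [<] nn b" using k(1) by simp_all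
    ultimately show "MEM (nn b) (nn c) (nn d) x"
      unfolding MEM_def k(2) modulus by blast
  qed
qed

lemma ex_MEM:
  assumes "finite S"
  shows "\<exists>b c d. N b \<and> N c \<and> N d \<and> (\<forall>x. MEM b c d x \<longleftrightarrow> x \<in> nn ` S)"
proof -
  obtain b c d where "\<And>k. k < b \<and> Suc (Suc k * d) dvd c \<longleftrightarrow> k \<in> S"
    using ex_set_code[OF assms] by blast
  then have "MEM (nn b) (nn c) (nn d) x \<longleftrightarrow> x \<in> nn ` S" for x
    unfolding MEM_nn by auto
  then show ?thesis using N_nn by blast
qed

end


section \<open>Codes of numerals and a self-referential sentence\<close>

text \<open>The recursion for the code of the n-th numeral, on pairs (n, code) and read backwards as
  in \<open>fm_rule\<close>. The tags 2, 3 and 4 belong to \<open>Zero\<close>, \<open>One\<close>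
  and addition; variable 0 is the pair and variables 1 to 3 give the set.\<close>

definition num_rule :: fm
  where "num_rule =
    (Var 0 \<approx> pair_tm Zero (op1 2 Zero)
    \<^bold>\<or> ExN (ExN (mem 3 (pair_tm (Var 1) (Var 0)) \<^bold>\<and>
        Var 2 \<approx> pair_tm (Var 1 \<oplus> One) (op2 4 (Var 0) (op1 3 Zero)))))"

definition num_code :: "tm \<Rightarrow> tm \<Rightarrow> fm"
  where "num_code n y =
    ExN (ExN (ExN (mem 0 (pair_tm (lifts 3 n) (lifts 3 y)) \<^bold>\<and> AllN (mem 1 (Var 0) \<^bold>\<longrightarrow> num_rule))))"

text \<open>Only standard \<open>n\<close> are treated, so induction outside the model suffices for
  uniqueness: in any set closed under the rule, even a nonstandard one, the pair for a successor can
  only be justified by a pair for its predecessor. For existence, the finite graph up to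
  \<open>n\<close> is coded.\<close>

lemma (in rkf_model) sat_num_code:
  assumes "N (eval_tm M e y)"
  shows "sat M e (num_code (num n) y) \<longleftrightarrow> eval_tm M e y = nn (code_tm (num n))"
proof -
  define C where "C b c d \<longleftrightarrow> (\<forall>u. N u \<longrightarrow> MEM b c d u \<longrightarrow> u = pr Z (pr (nn 2) Z) \<or>
    (\<exists>v. N v \<and> (\<exists>w. MEM b c d (pr v w) \<and> N w \<and> u = pr (v [+] U) (pr (nn 4) (pr w (pr (nn 3) Z))))))"
    for b c d
  have sat: "sat M e (num_code (num n) y) \<longleftrightarrow>
    (\<exists>b. N b \<and> (\<exists>c. N c \<and> (\<exists>d. MEM b c d (pr (nn n) (eval_tm M e y)) \<and> N d \<and> C b c d)))"
    by (simp add: num_code_def num_rule_def C_def lifts_3)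
  have unique: "z = nn (code_tm (num n))" if "C b c d" "MEM b c d (pr (nn n) z)" "N z" for b c d z n
    using that
  proof (induction n arbitrary: z)
    case 0
    then have "N (pr Z z)" "MEM b c d (pr Z z)" by (simp_all add: nn_simps)
    then have "pr Z z = pr Z (pr (nn 2) Z) \<or>
      (\<exists>v. N v \<and> (\<exists>w. MEM b c d (pr v w) \<and> N w \<and> pr Z z = pr (v [+] U) (pr (nn 4) (pr w (pr (nn 3) Z)))))"
      using 0(1) unfolding C_def by blast
    moreover have "pr Z z \<noteq> pr (v [+] U) (pr (nn 4) (pr w (pr (nn 3) Z)))" if "N v" "N w" for v w
    proof -
      have "v [+] U \<noteq> Z"
        using N_nonneg[OF that(1)] F.add_nonneg_pos[of v U] field_axioms(11) F.zero_less_one by metis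
      then show ?thesis using that \<open>N z\<close> by simp
    qed
    ultimately have "pr Z z = pr Z (pr (nn 2) Z)" by blast
    then show ?case using \<open>N z\<close> by (simp add: nn_simps)
  next
    case (Suc n)
    then have "N (pr (nn n [+] U) z)" "MEM b c d (pr (nn n [+] U) z)" by (simp_all add: nn_simps)
    then have "pr (nn n [+] U) z = pr Z (pr (nn 2) Z) \<or>
      (\<exists>v. N v \<and> (\<exists>w. MEM b c d (pr v w) \<and> N w \<and> pr (nn n [+] U) z = pr (v [+] U) (pr (nn 4) (pr w (pr (nn 3) Z)))))"
      using Suc.prems(1) unfolding C_def by blast
    moreover have "nn n [+] U \<noteq> Z"
      using nn_inject[of "Suc n" 0] unfolding nn_simps by simp
    ultimately obtain w where "N w" "MEM b c d (pr (nn n) w)" "z = pr (nn 4) (pr w (pr (nn 3) Z))"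
      using Suc.prems by auto
    with Suc.IH Suc.prems(1) show ?case by (simp add: nn_simps)
  qed
  let ?S = "(\<lambda>m. pair m (code_tm (num m))) ` {..n}"
  obtain b c d where bcd: "N b" "N c" "N d" "\<And>x. MEM b c d x \<longleftrightarrow> x \<in> nn ` ?S"
    using ex_MEM[of ?S] by auto
  have mem: "MEM b c d x \<longleftrightarrow> (\<exists>m\<le>n. x = pr (nn m) (nn (code_tm (num m))))" for x
    unfolding bcd by (auto simp: image_image)
  have "C b c d"
    unfolding C_def
  proof (intro allI impI)
    fix u assume "MEM b c d u"
    then obtain m where m: "m \<le> n" "u = pr (nn m) (nn (code_tm (num m)))"
      unfolding mem by blast
    show "u = pr Z (pr (nn 2) Z) \<or>
      (\<exists>v. N v \<and> (\<exists>w. MEM b c d (pr v w) \<and> N w \<and> u = pr (v [+] U) (pr (nn 4) (pr w (pr (nn 3) Z)))))"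
    proof (cases m)
      case 0
      then show ?thesis using m by (simp add: nn_simps)
    next
      case (Suc k)
      have "MEM b c d (pr (nn k) (nn (code_tm (num k))))"
        unfolding mem using m Suc by (intro exI[of _ k]) simp
      then show ?thesis using m Suc
        by (intro disjI2 exI[of _ "nn k"] conjI exI[of _ "nn (code_tm (num k))"]) (simp_all add: nn_simps)
    qed
  qed
  moreover have "MEM b c d (pr (nn n) (nn (code_tm (num n))))"
    unfolding mem by blast
  ultimately have "sat M e (num_code (num n) y)" if "eval_tm M e y = nn (code_tm (num n))"
    unfolding sat that using bcd(1-3) by blast
  moreover have "eval_tm M e y = nn (code_tm (num n))" if "sat M e (num_code (num n) y)"
    using that unique assms unfolding sat by blast
  ultimately show ?thesis by blast
qed

text \<open>
  \<open>liar_body\<close> says of a number \<open>x\<close>: if \<open>x\<close> codes the formula \<open>\<psi>\<close>, then the sentence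
  \<open>\<forall>x (x = \<lceil>\<psi>\<rceil> \<longrightarrow> \<psi>)\<close> does not have probability 1. The code of that sentence is a term in \<open>x\<close> and
  the code \<open>y\<close> of the numeral \<open>\<lceil>\<psi>\<rceil>\<close>, so numeral codes are the only syntactic function that has to be
  represented.
\<close>

definition liar_body :: fm
  where "liar_body = AllN (num_code (Var 1) (Var 0) \<^bold>\<longrightarrow>
    \<^bold>\<not> Prob (op1 15 (op2 14 (op1 12 (op2 8 (op1 1 Zero) (Var 0))) (Var 1))) (rat_tm 1))"

definition liar :: fm
  where "liar = All (Var 0 \<approx> \<lceil>liar_body\<rceil> \<^bold>\<longrightarrow> liar_body)"

text \<open>With \<open>rat_tm 1\<close> in place of \<open>One\<close>, this is literally the
  condition in \<open>RV_instance liar 1\<close>.\<close>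

definition liar_sure :: fm
  where "liar_sure = Prob \<lceil>liar\<rceil> (rat_tm 1)"

lemma rat_tm_1: "rat_tm 1 = (Zero \<oplus> One) \<otimes> Inv (Zero \<oplus> One)"
  by (simp add: rat_tm_def int_tm_def)

lemma sentence_liar: "sentence liar"
  by (simp add: sentence_def liar_def liar_body_def quot_def num_code_def num_rule_def mem_def
      op1_def op2_def pair_tm_def rat_tm_1 numeral_3_eq_3 numeral_2_eq_2)

lemma sentence_liar_sure: "sentence liar_sure"
  by (simp add: sentence_def liar_sure_def quot_def rat_tm_1)

section \<open>The self-referential sentence in a model\<close>

context rkf_model
begin

lemma eval_quot [simp]: "eval_tm M e \<lceil>\<phi>\<rceil> = nn (code_fm \<phi>)"
  by (simp add: quot_def)

lemma eval_rat_tm_1 [simp]: "eval_tm M e (rat_tm 1) = U"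
  using field_axioms(9) field_axioms(10)[of U] by (simp add: rat_tm_1)

text \<open>Diagonalization: at its own code, \<open>liar_body\<close> speaks about the sentence
  whose code is computed from that code and from the code of its numeral, and this sentence is
  \<open>liar\<close>.\<close>

lemma sat_liar: "sat M e liar \<longleftrightarrow> \<not> sat M e liar_sure"
proof -
  let ?g = "nn (code_fm liar_body)"
  let ?n = "nn (code_tm \<lceil>liar_body\<rceil>)"
  \<comment> \<open>Variable 1 has the same value as the numeral for the code of
    \<open>liar_body\<close>, so it may be replaced by that numeral, as \<open>sat_num_code\<close>
    requires.\<close>
  have num: "sat M (y ## ?g ## e) (num_code (Var 1) (Var 0)) \<longleftrightarrow> y = ?n" if "N y" for y
  proof -
    have "sat M (y ## ?g ## e) (num_code (Var 1) (Var 0)) \<longleftrightarrow>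
      sat M (y ## ?g ## e) (num_code \<lceil>liar_body\<rceil> (Var 0))"
      by (simp add: num_code_def quot_def lifts_3)
    also have "\<dots> \<longleftrightarrow> y = ?n"
      unfolding quot_def using that by (subst sat_num_code) simp_all
    finally show ?thesis .
  qed
  have body: "sat M (x ## e) liar_body \<longleftrightarrow>
    (\<forall>y. N y \<longrightarrow> sat M (y ## x ## e) (num_code (Var 1) (Var 0)) \<longrightarrow>
      \<not> P (pr (nn 15) (pr (nn 14) (pr (pr (nn 12) (pr (nn 8) (pr (pr (nn 1) Z) y))) x))) U)" for x
    by (auto simp: liar_body_def)
  have "sat M e liar \<longleftrightarrow> sat M (?g ## e) liar_body"
    by (auto simp: liar_def)
  also have "\<dots> \<longleftrightarrow> \<not> P (pr (nn 15) (pr (nn 14) (pr (pr (nn 12) (pr (nn 8) (pr (pr (nn 1) Z) ?n))) ?g))) U"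
    unfolding body using num N_nn by blast
  \<comment> \<open>The tags 15, 14, 12, 8 and 1 stand for \<open>All\<close>, \<open>Disj\<close>,
    \<open>Neg\<close>, \<open>Eq\<close> and \<open>Var\<close>; \<open>Z\<close> is the index of
    the bound variable.\<close>
  also have "pr (nn 15) (pr (nn 14) (pr (pr (nn 12) (pr (nn 8) (pr (pr (nn 1) Z) ?n))) ?g)) = nn (code_fm liar)"
    by (simp add: liar_def nn_simps(1))
  also have "P \<dots> U \<longleftrightarrow> sat M e liar_sure"
    by (simp add: liar_sure_def)
  finally show ?thesis .
qed

text \<open>
  A formula is a sentence in the sense of the model if its code and bound \<open>0\<close> lie in a set of pairs
  that is closed under \<open>fm_rule\<close> read backwards; the same set then works for its subformulas.
\<close>

definition JUST :: "'a \<Rightarrow> 'a \<Rightarrow> 'a \<Rightarrow> 'a \<Rightarrow> bool"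
  where "JUST b c d u \<longleftrightarrow> sat M (u ## d ## c ## b ## (\<lambda>_. Z)) fm_rule"

definition SENT :: "'a \<Rightarrow> bool"
  where "SENT x \<longleftrightarrow> N x \<and> (\<exists>b c d. N b \<and> N c \<and> N d \<and> MEM b c d (pr x Z) \<and>
    (\<forall>u. N u \<longrightarrow> MEM b c d u \<longrightarrow> JUST b c d u))"

lemma sat_fm_rule: "sat M (u ## d ## c ## b ## e) fm_rule \<longleftrightarrow> JUST b c d u"
  unfolding JUST_def
proof (rule sat_cong)
  show "closed_fm 4 fm_rule"
    by (simp add: fm_rule_def tm_code_def tm_rule_def mem_def op1_def op2_def pair_tm_def lifts_3)
  show "(u ## d ## c ## b ## e) i = (u ## d ## c ## b ## (\<lambda>_. Z)) i" if "i < 4" for i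
    using that by (auto simp: less_Suc_eq numeral_eq_Suc)
qed

lemma sat_sent [simp]: "sat M e (sent t) \<longleftrightarrow> SENT (eval_tm M e t)"
  by (simp add: sent_def fm_code_def lifts_3 sat_fm_rule SENT_def) blast

text \<open>Tag 14 rules out every other clause of \<open>fm_rule\<close>, and injectivity of
  \<open>pr\<close> on \<open>N\<close> identifies the components found there with \<open>x\<close>
  and \<open>y\<close>. The bound \<open>Z\<close> is passed on unchanged.\<close>

lemma JUST_Disj:
  assumes "JUST b c d (pr (pr (nn 14) (pr x y)) Z)" "N x" "N y"
  shows "MEM b c d (pr x Z) \<and> MEM b c d (pr y Z)"
  using assms by (auto simp: JUST_def fm_rule_def)

text \<open>Together with \<open>prob_SENT\<close> this yields sentencehood in the model without
  constructing a set code for any concrete formula.\<close>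

lemma SENT_DisjD:
  assumes "SENT (nn (code_fm (\<phi> \<^bold>\<or> \<psi>)))"
  shows "SENT (nn (code_fm \<phi>)) \<and> SENT (nn (code_fm \<psi>))"
proof -
  let ?u = "pr (pr (nn 14) (pr (nn (code_fm \<phi>)) (nn (code_fm \<psi>)))) Z"
  obtain b c d where bcd: "N b" "N c" "N d" "MEM b c d ?u"
    "\<forall>u. N u \<longrightarrow> MEM b c d u \<longrightarrow> JUST b c d u"
    using assms by (auto simp: SENT_def)
  then have "JUST b c d ?u" by simp
  then have "MEM b c d (pr (nn (code_fm \<phi>)) Z) \<and> MEM b c d (pr (nn (code_fm \<psi>)) Z)"
    by (rule JUST_Disj) simp_all
  with bcd show ?thesis unfolding SENT_def by (meson N_nn)
qed

section \<open>Probability laws in a model\<close>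

lemma prob_unique: "P x y \<Longrightarrow> P x z \<Longrightarrow> y = z"
  using sat_ax[of "Prob x0 x1 \<^bold>\<and> Prob x0 x2 \<^bold>\<longrightarrow> x1 \<approx> x2" "x ## y ## z ## (\<lambda>_. Z)"]
  by (simp add: RKf_def pr_function_def)

lemma prob_SENT: "P x y \<Longrightarrow> SENT x"
  using sat_ax[of pr_range "x ## y ## (\<lambda>_. Z)"] by (simp add: RKf_def pr_range_def)

lemma prob_Disj:
  assumes "SENT (nn (code_fm \<phi>))" "SENT (nn (code_fm \<psi>))"
  obtains p q r s where "P (nn (code_fm (\<phi> \<^bold>\<or> \<psi>))) p" "P (nn (code_fm \<phi>)) q" "P (nn (code_fm \<psi>)) r"
    "P (nn (code_fm (\<phi> \<^bold>\<and> \<psi>))) s" "p = q [+] r [-] s"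
  using sat_ax[of pr_disj "nn (code_fm \<phi>) ## nn (code_fm \<psi>) ## (\<lambda>_. Z)"] assms
  by (auto simp: RKf_def pr_disj_def)

lemma prob_Neg:
  assumes "P (nn (code_fm \<phi>)) q"
  shows "P (nn (code_fm (\<^bold>\<not> \<phi>))) (U [-] q)"
proof -
  obtain p r where "P (nn (code_fm (\<^bold>\<not> \<phi>))) p" "P (nn (code_fm \<phi>)) r" "p = U [-] r"
    using sat_ax[of pr_neg "nn (code_fm \<phi>) ## (\<lambda>_. Z)"] prob_SENT[OF assms]
    by (auto simp: RKf_def pr_neg_def)
  moreover from this have "q = r" using prob_unique assms by blast
  ultimately show ?thesis by simp
qed

lemma prob_nec: "sentence \<phi> \<Longrightarrow> RKf \<union> RV \<turnstile> \<phi> \<Longrightarrow> P (nn (code_fm \<phi>)) U"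
  using sat_derivable[OF nec, of \<phi>] by simp

lemma prob_RV:
  assumes "sentence \<phi>" "P (nn (code_fm (Prob \<lceil>\<phi>\<rceil> (rat_tm 1)))) p" "p \<noteq> Z"
    "P (nn (code_fm (\<phi> \<^bold>\<and> Prob \<lceil>\<phi>\<rceil> (rat_tm 1)))) q"
  shows "q [*] inv_of M p = U"
proof -
  have "sat M (\<lambda>_. Z) (RV_instance \<phi> 1)"
    using assms(1) by (intro sat_ax) (auto simp: RV_def)
  then obtain q' p' where "P (nn (code_fm (\<phi> \<^bold>\<and> Prob \<lceil>\<phi>\<rceil> (rat_tm 1)))) q'"
    "P (nn (code_fm (Prob \<lceil>\<phi>\<rceil> (rat_tm 1)))) p'" "q' [*] inv_of M p' = U"
    using assms(2,3) by (auto simp: RV_instance_def Let_def simp del: code_fm.simps)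
  moreover from this have "p' = p" "q' = q" using prob_unique assms by blast+
  ultimately show ?thesis by simp
qed

text \<open>The equivalence is assumed as a theorem rather than as true in this model, because
  Necessitation is applied to two of its consequences.\<close>

lemma liar_sure_prob:
  assumes "RKf \<union> RV \<turnstile> liar \<^bold>\<longleftrightarrow> \<^bold>\<not> liar_sure"
  shows "P (nn (code_fm liar)) U" "P (nn (code_fm liar_sure)) Z"
proof -
  have "RKf \<union> RV \<turnstile> liar \<^bold>\<or> liar_sure" "RKf \<union> RV \<turnstile> \<^bold>\<not> (liar \<^bold>\<and> liar_sure)"
    using assms by (rule taut_mp, auto simp: tautology_def)+
  then have disj: "P (nn (code_fm (liar \<^bold>\<or> liar_sure))) U"
    and neg: "P (nn (code_fm (\<^bold>\<not> (liar \<^bold>\<and> liar_sure)))) U"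
    using sentence_liar sentence_liar_sure by (auto intro!: prob_nec simp: sentence_def simp del: code_fm.simps)
  \<comment> \<open>The axiom on disjunctions presupposes sentences. That the disjunction is one
    follows from its having a probability at all.\<close>
  have "SENT (nn (code_fm liar)) \<and> SENT (nn (code_fm liar_sure))"
    using prob_SENT[OF disj] by (rule SENT_DisjD)
  then obtain p q r s where pqrs: "P (nn (code_fm (liar \<^bold>\<or> liar_sure))) p"
    "P (nn (code_fm liar)) q" "P (nn (code_fm liar_sure)) r"
    "P (nn (code_fm (liar \<^bold>\<and> liar_sure))) s" "p = q [+] r [-] s"
    using prob_Disj by blast
  have p: "p = U" using prob_unique[OF pqrs(1) disj] .
  have "U = U [-] s" using prob_unique[OF neg prob_Neg[OF pqrs(4)]] .
  then have s: "s = Z" using F.diff_0_right F.diff_left_imp_eq by metis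
  have r: "r = Z"
  proof (rule ccontr)
    assume "r \<noteq> Z"
    then have "s [*] inv_of M r = U"
      using prob_RV[OF sentence_liar, of r s] pqrs unfolding liar_sure_def by blast
    then show False using field_axioms(9) by (simp add: s)
  qed
  have "q = U" using pqrs(5) by (simp add: p r s)
  with pqrs(2,3) r show "P (nn (code_fm liar)) U" "P (nn (code_fm liar_sure)) Z" by simp_all
qed

end

theorem proposition6:
  shows "inconsistent (RKf \<union> RV)"
proof -
  let ?A = "RKf \<union> RV"
  have field: "ordered_field_axioms \<subseteq> ?A"
    by (auto simp: RKf_def Q_pr_def rational_axioms_def)
  \<comment> \<open>Truth in all models is turned back into a theorem, to which Necessitation can be
    applied in the next stage.\<close>
  have "?A \<turnstile> liar \<^bold>\<longleftrightarrow> \<^bold>\<not> liar_sure"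
  proof (rule completeness[OF field])
    fix M :: "nat struct" and e assume "model ?A M"
    then interpret rkf_model M by unfold_locales
    show "sat M e (liar \<^bold>\<longleftrightarrow> \<^bold>\<not> liar_sure)" using sat_liar by auto
  qed
  note liar = this
  \<comment> \<open>Probability 1 for \<open>liar\<close> holds in every model, so the sentence
    stating it is a theorem and Necessitation applies once more.\<close>
  have sure: "?A \<turnstile> liar_sure"
  proof (rule completeness[OF field])
    fix M :: "nat struct" and e assume "model ?A M"
    then interpret rkf_model M by unfold_locales
    show "sat M e liar_sure" using liar_sure_prob(1)[OF liar] by (simp add: liar_sure_def)
  qed
  \<comment> \<open>In a model \<open>liar_sure\<close> would have both probability 1 and
    probability 0. Hence there are no models on \<open>nat\<close>, and every formula is valid
    vacuously.\<close>
  have "?A \<turnstile> \<phi>" for \<phi>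
  proof (rule completeness[OF field])
    fix M :: "nat struct" and e assume "model ?A M"
    then interpret rkf_model M by unfold_locales
    have "U = Z"
      using prob_unique[OF prob_nec[OF sentence_liar_sure sure] liar_sure_prob(2)[OF liar]] .
    then show "sat M e \<phi>" using field_axioms(9) by simp
  qed
  then show ?thesis unfolding inconsistent_def by blast
qed

end
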